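(* Let $k$ be any positive integer. Then $\alpha(Q_8 \times C_2^k) = 16 + 2k$.
   Context: All graphs are finite, simple and undirected. For a finite group $G$, $\alpha(G)$ denotes the minimum number of vertices of a graph $\Gamma$ whose full automorphism group $\mathrm{Aut}\,\Gamma$ is isomorphic to $G$. $Q_8=\langle \sigma,\tau \mid \sigma^4=\tau^4=1,\ \sigma^2=\tau^2,\ \sigma\tau=\tau\sigma^{-1}\rangle$ is the quaternion group of order $8$, and $C_2^k$ is the elementary abelian group of order $2^k$ (direct product of $k$ copies of the cyclic group $C_2$ of order $2$). *)

theory Defs
  imports "HOL-Algebra.Algebra"
begin

definition simple_graph :: "'v set \<Rightarrow> ('v \<Rightarrow> 'v \<Rightarrow> bool) \<Rightarrow> bool" where
  "simple_graph V E \<longleftrightarrow> finite V \<and> (\<forall>x\<in>V. \<forall>y\<in>V. E x y \<longleftrightarrow> E y x) \<and> (\<forall>x\<in>V. \<not> E x x)"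

definition graph_aut_group :: "'v set \<Rightarrow> ('v \<Rightarrow> 'v \<Rightarrow> bool) \<Rightarrow> ('v \<Rightarrow> 'v) monoid" where
  "graph_aut_group V E = BijGroup V
     \<lparr>carrier := {f \<in> Bij V. \<forall>x\<in>V. \<forall>y\<in>V. E x y \<longleftrightarrow> E (f x) (f y)}\<rparr>"

text \<open>alpha(G): the minimum number of vertices of a graph whose full automorphism group
is isomorphic to G (graphs on {0..<n}, which loses no generality up to isomorphism).\<close>
definition alpha :: "('a, 'b) monoid_scheme \<Rightarrow> nat" where
  "alpha G = (LEAST n. \<exists>E. simple_graph {..<n} E \<and> graph_aut_group {..<n} E \<cong> G)"

text \<open>Quaternion group Q8, realised on normal forms sigma^a tau^b (a in {0..3}, b in {0,1}),
using tau sigma = sigma^-1 tau and tau^2 = sigma^2 (consequences of the presentation).\<close>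
definition Q8 :: "(int \<times> int) monoid" where
  "Q8 = \<lparr>carrier = {0..<4} \<times> {0..<2},
         monoid.mult = (\<lambda>(a,b) (c,d).
            ((a + (if b = 0 then c else - c) + (if b = 1 \<and> d = 1 then 2 else 0)) mod 4,
             (b + d) mod 2)),
         one = (0, 0)\<rparr>"

abbreviation C2 :: "int monoid" where "C2 \<equiv> integer_mod_group 2"

definition elem_abelian_2 :: "nat \<Rightarrow> (nat \<Rightarrow> int) monoid" where
  "elem_abelian_2 k = product_group {..<k} (\<lambda>_. C2)"

end

theory Submission
  imports Defs
begin

text \<open>
  Let \<open>G = Q\<^sub>8 \<times> C\<^sub>2\<^sup>k\<close> act as the full automorphism group of a graph, let \<open>z\<close> be the element of order 2 in
  \<open>Q\<^sub>8\<close> and \<open>Z\<close> the centre of \<open>G\<close>, of order \<open>2^(k+1)\<close>. Every element outside \<open>Z\<close> squares to \<open>z\<close>, so a vertex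
  \<open>x\<close> moved by \<open>z\<close> has its stabilizer \<open>H\<^sub>x\<close> inside \<open>Z\<close>, and \<open>|Gx| = 4|Zx|\<close>. For the same reason two
  vertices of \<open>Gx\<close> in different \<open>Z\<close>-orbits satisfy \<open>u \<sim> v\<close> iff \<open>zu \<sim> v\<close>. Hence applying \<open>z\<close> on \<open>Zx\<close>
  only would be a graph automorphism outside \<open>G\<close>, unless there is a second orbit \<open>Gy\<close> moved by \<open>z\<close> such
  that \<open>H\<^sub>x = H\<^sub>y\<close> or one of \<open>Zx\<close>, \<open>Zy\<close> has more than two elements. Then
  \<open>H\<^sub>x \<inter> H\<^sub>y\<close> acts faithfully on the \<open>w\<close> vertices outside \<open>Gx \<union> Gy\<close>, which gives
  \<open>|H\<^sub>x \<inter> H\<^sub>y|^2 \<le> 2^w\<close> and, after counting, at least \<open>16 + 2k\<close> vertices.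

  The bound is attained by starting from a graph with 16 vertices and group \<open>Q\<^sub>8\<close>, consisting of two regular
  orbits, and repeatedly adding two isolated vertices and passing to the complement.
\<close>

section \<open>Abelian 2-groups of permutations\<close>

lemma (in group_action) subgroup_action:
  assumes "subgroup K G"
  shows "group_action (G\<lparr>carrier := K\<rparr>) E \<phi>"
proof -
  have "\<phi> \<in> hom (G\<lparr>carrier := K\<rparr>) (BijGroup E)"
    using group_hom.homh[OF group_hom] subgroup.subset[OF assms] by (auto simp: hom_def)
  moreover have "group (G\<lparr>carrier := K\<rparr>)"
    using assms group_hom by (simp add: group_hom_def subgroup.subgroup_is_group)
  ultimately show ?thesis
    by (simp add: group_action_def group_hom_def group_hom_axioms_def group_BijGroup)
qed

lemma (in group_action) subgroup_orbit_stabilizer: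
  assumes "subgroup K G" "x \<in> E"
  shows "card ((\<lambda>g. \<phi> g x) ` K) * card {g \<in> K. \<phi> g x = x} = card K"
proof -
  interpret K: group_action "G\<lparr>carrier := K\<rparr>" E \<phi>
    by (rule subgroup_action) fact
  have "orbit (G\<lparr>carrier := K\<rparr>) \<phi> x = (\<lambda>g. \<phi> g x) ` K"
    by (auto simp: orbit_def)
  then show ?thesis
    using K.orbit_stabilizer_theorem[OF assms(2)] by (simp add: stabilizer_def order_def)
qed

lemma (in group_action) subgroup_point_stabilizer:
  assumes "subgroup K G" "x \<in> E"
  shows "subgroup {g \<in> K. \<phi> g x = x} G"
proof -
  have "{g \<in> K. \<phi> g x = x} = K \<inter> stabilizer G \<phi> x"
    using subgroup.subset[OF assms(1)] by (auto simp: stabilizer_def)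
  then show ?thesis
    using assms stabilizer_subgroup group_hom
    by (simp add: group.subgroups_Inter_pair group_hom_def)
qed

text \<open>At \<open>t = 3\<close> the inequality fails, since \<open>9 > 8\<close>. Orbit lengths
  of a 2-group avoid this value.\<close>

lemma square_le_two_power:
  fixes t :: nat
  assumes "t \<noteq> 3"
  shows "t ^ 2 \<le> 2 ^ t"
proof (cases "t < 4")
  case True
  then consider "t = 0" | "t = 1" | "t = 2" using assms by linarith
  then show ?thesis by cases auto
next
  case False
  then have "4 \<le> t" by simp
  then show ?thesis
  proof (induction t rule: dec_induct)
    case (step t)
    have "(Suc t) ^ 2 \<le> 2 * t ^ 2"
    proof -
      have "4 * t \<le> t * t" using step(1) by simp
      then have "2 * t + 1 \<le> t * t" using step(1) by linarith
      then show ?thesis by (simp add: power2_eq_square)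
    qed
    also have "\<dots> \<le> 2 ^ Suc t" using step.IH by simp
    finally show ?case .
  qed simp
qed

text \<open>Split off one orbit \<open>B\<close> at a time. In an abelian group the stabilizer of a
  point fixes the whole orbit of that point, so it acts faithfully on \<open>W - B\<close>; the
  factor lost is \<open>card B\<close>, whose square is at most \<open>2 ^ card B\<close>. The
  squared form avoids halving \<open>card W\<close>.\<close>

lemma (in group_action) abelian_two_subgroup_bound:
  assumes "finite W" "W \<subseteq> E" "subgroup K G" "card K dvd 2 ^ m"
    and comm: "\<And>g h. g \<in> K \<Longrightarrow> h \<in> K \<Longrightarrow> g \<otimes> h = h \<otimes> g"
    and inv: "\<And>g x. g \<in> K \<Longrightarrow> x \<in> W \<Longrightarrow> \<phi> g x \<in> W"
    and faithful: "\<And>g. g \<in> K \<Longrightarrow> (\<And>x. x \<in> W \<Longrightarrow> \<phi> g x = x) \<Longrightarrow> g = \<one>"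
  shows "card K ^ 2 \<le> 2 ^ card W"
  using assms
proof (induction "card W" arbitrary: W K rule: less_induct)
  case less
  show ?case
  proof (cases "W = {}")
    case True
    then have "K \<subseteq> {\<one>}" using less.prems(7) by blast
    then have "card K \<le> card {\<one>}" by (intro card_mono) auto
    then have "card K \<le> 1" by simp
    then show ?thesis by (cases "card K") auto
  next
    case False
    then obtain x where x: "x \<in> W" "x \<in> E" using less.prems(2) by blast
    define B where "B = (\<lambda>g. \<phi> g x) ` K"
    define L where "L = {g \<in> K. \<phi> g x = x}"
    have KG: "K \<subseteq> carrier G" using less.prems(3) by (rule subgroup.subset)
    have card_K: "card B * card L = card K"
      unfolding B_def L_def using less.prems(3) x(2) by (rule subgroup_orbit_stabilizer)
    have "\<one> \<in> K" using less.prems(3) by (rule subgroup.one_closed)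
    then have xB: "x \<in> B"
      unfolding B_def using id_eq_one x(2) by (metis image_eqI restrict_apply')
    have B: "B \<subseteq> W" using less.prems(6) x(1) by (auto simp: B_def)
    \<comment> \<open>Commutativity enters here: \<open>g h x = h g x = h x\<close>.\<close>
    have L_fix: "\<phi> g y = y" if "g \<in> L" "y \<in> B" for g y
    proof -
      obtain h where h: "h \<in> K" "y = \<phi> h x" using \<open>y \<in> B\<close> by (auto simp: B_def)
      have g: "g \<in> K" "\<phi> g x = x" using \<open>g \<in> L\<close> by (auto simp: L_def)
      have "\<phi> g (\<phi> h x) = \<phi> h (\<phi> g x)"
        using composition_rule[OF x(2), of g h] composition_rule[OF x(2), of h g]
          less.prems(5)[of g h] g(1) h(1) KG by (metis subsetD)
      then show ?thesis using g h by simp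
    qed
    \<comment> \<open>The orbit length divides a power of two, which excludes the exceptional value
      of \<open>square_le_two_power\<close>.\<close>
    have "card B \<noteq> 3"
    proof
      assume "card B = 3"
      then have "3 dvd (2::nat) ^ m" using card_K less.prems(4) by (metis dvd_mult_left)
      moreover have "coprime (3::nat) (2 ^ m)" by (simp add: coprime_commute)
      ultimately show False by (metis coprime_absorb_left nat_dvd_1_iff_1 numeral_eq_one_iff semiring_norm(86))
    qed
    then have B_bound: "card B ^ 2 \<le> 2 ^ card B" by (rule square_le_two_power)
    have finB: "finite B" using B less.prems(1) by (rule finite_subset)
    have "card L ^ 2 \<le> 2 ^ card (W - B)"
    proof (rule less.hyps)
      show "card (W - B) < card W"
        using xB B less.prems(1) by (intro psubset_card_mono) auto
      show "finite (W - B)" "W - B \<subseteq> E" using less.prems by auto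
      show "subgroup L G"
        unfolding L_def using less.prems(3) x(2) by (rule subgroup_point_stabilizer)
      show "card L dvd 2 ^ m" using card_K less.prems(4) by (metis dvd_mult_right)
      show "g \<otimes> h = h \<otimes> g" if "g \<in> L" "h \<in> L" for g h
        using that less.prems(5) by (simp add: L_def)
      show "\<phi> g y \<in> W - B" if "g \<in> L" "y \<in> W - B" for g y
      proof -
        have g: "g \<in> K" "g \<in> carrier G" using that KG by (auto simp: L_def)
        have "\<phi> g y \<in> W" using that less.prems(6) by (auto simp: L_def)
        \<comment> \<open>\<open>g\<close> fixes \<open>B\<close> pointwise, so by injectivity only
          points of \<open>B\<close> can land in \<open>B\<close>.\<close>
        moreover have "\<phi> g y \<notin> B"
        proof
          assume *: "\<phi> g y \<in> B"
          then have "\<phi> g (\<phi> g y) = \<phi> g y" by (rule L_fix[OF \<open>g \<in> L\<close>])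
          then have "\<phi> g y = y"
            using inj_prop[OF g(2)] that \<open>\<phi> g y \<in> W\<close> less.prems(2) by (auto dest: inj_onD)
          with * that show False by simp
        qed
        ultimately show ?thesis by simp
      qed
      show "g = \<one>" if "g \<in> L" "\<And>y. y \<in> W - B \<Longrightarrow> \<phi> g y = y" for g
      proof (rule less.prems(7))
        show "g \<in> K" using that(1) by (simp add: L_def)
        show "\<phi> g y = y" if "y \<in> W" for y
          using that L_fix \<open>g \<in> L\<close> \<open>\<And>y. y \<in> W - B \<Longrightarrow> \<phi> g y = y\<close> by blast
      qed
    qed
    then have "card B ^ 2 * card L ^ 2 \<le> 2 ^ card B * 2 ^ card (W - B)"
      using B_bound by (intro mult_le_mono)
    also have "\<dots> = 2 ^ card W"
      using B finB less.prems(1) by (simp add: card_Diff_subset card_mono flip: power_add)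
    finally show ?thesis by (simp add: card_K flip: power_mult_distrib)
  qed
qed

section \<open>The lower bound for actions of a central extension\<close>

text \<open>The lower bound sees the group only through this interface: a central subgroup
  \<open>Z\<close> of order \<open>2^(k+1)\<close> and index 4, with all squares outside
  \<open>Z\<close> equal to \<open>z\<close>. By \<open>image_iff\<close> the action reaches every
  graph automorphism, which is what makes an extra automorphism contradictory.\<close>

locale quaternionic_graph_action = group_action +
  fixes adj :: "'c \<Rightarrow> 'c \<Rightarrow> bool" and Z z k
  assumes finite_E: "finite E"
    and faithful: "inj_on \<phi> (carrier G)"
    and sym: "\<And>x y. x \<in> E \<Longrightarrow> y \<in> E \<Longrightarrow> adj x y \<longleftrightarrow> adj y x"
    and image_iff: "\<And>f. f \<in> \<phi> ` carrier G \<longleftrightarrow>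
      f \<in> Bij E \<and> (\<forall>x\<in>E. \<forall>y\<in>E. adj x y \<longleftrightarrow> adj (f x) (f y))"
    and Z_subgroup: "subgroup Z G"
    and Z_central: "\<And>g h. g \<in> Z \<Longrightarrow> h \<in> carrier G \<Longrightarrow> g \<otimes> h = h \<otimes> g"
    and card_Z: "card Z = 2 ^ Suc k"
    and order_G: "order G = 4 * card Z"
    and z: "z \<in> Z" "z \<noteq> \<one>" "z \<otimes> z = \<one>"
    and square: "\<And>g. g \<in> carrier G \<Longrightarrow> g \<notin> Z \<Longrightarrow> g \<otimes> g = z"
begin

sublocale group G using group_hom by (simp add: group_hom_def)

section \<open>Orbits and stabilizers of the central subgroup\<close>

definition "central_orbit x = (\<lambda>g. \<phi> g x) ` Z"

definition "central_stabilizer x = {g \<in> Z. \<phi> g x = x}"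

lemma Z_carrier: "g \<in> Z \<Longrightarrow> g \<in> carrier G"
  using subgroup.subset[OF Z_subgroup] by blast

lemma finite_Z: "finite Z"
  using card_Z by (metis card.infinite nat_zero_less_power_iff less_numeral_extra(3) zero_less_numeral)

lemma action_closed: "g \<in> carrier G \<Longrightarrow> x \<in> E \<Longrightarrow> \<phi> g x \<in> E"
  by (rule element_image) auto

lemma action_cancel: "g \<in> carrier G \<Longrightarrow> x \<in> E \<Longrightarrow> y \<in> E \<Longrightarrow> \<phi> g x = \<phi> g y \<longleftrightarrow> x = y"
  using inj_prop by (auto dest: inj_onD)

lemma action_one: "x \<in> E \<Longrightarrow> \<phi> \<one> x = x"
  using id_eq_one by (metis restrict_apply')

lemma action_commute:
  "g \<in> Z \<Longrightarrow> h \<in> carrier G \<Longrightarrow> x \<in> E \<Longrightarrow> \<phi> g (\<phi> h x) = \<phi> h (\<phi> g x)"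
  using composition_rule[of x g h] composition_rule[of x h g] Z_central[of g h] Z_carrier by simp

lemma adj_invariant:
  "g \<in> carrier G \<Longrightarrow> x \<in> E \<Longrightarrow> y \<in> E \<Longrightarrow> adj (\<phi> g x) (\<phi> g y) \<longleftrightarrow> adj x y"
  using image_iff[of "\<phi> g"] by blast

text \<open>An element outside \<open>Z\<close> has square \<open>z\<close>, so it cannot fix
  \<open>x\<close> unless \<open>z\<close> does.\<close>

lemma stabilizer_central:
  assumes "x \<in> E" "\<phi> z x \<noteq> x" "g \<in> carrier G" "\<phi> g x = x"
  shows "g \<in> Z"
proof (rule ccontr)
  assume "g \<notin> Z"
  then have "\<phi> z x = \<phi> g (\<phi> g x)"
    using square composition_rule assms by metis
  with assms show False by simp
qed

lemma central_orbit_stabilizer: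
  assumes "x \<in> E"
  shows "card (central_orbit x) * card (central_stabilizer x) = card Z"
  unfolding central_orbit_def central_stabilizer_def
  using Z_subgroup assms by (rule subgroup_orbit_stabilizer)

lemma card_central_stabilizer_pos:
  assumes "x \<in> E"
  shows "card (central_stabilizer x) > 0"
proof -
  have "card Z > 0" using card_Z by simp
  with central_orbit_stabilizer[OF assms] show ?thesis
    by (metis mult_0_right neq0_conv)
qed

lemma central_orbit_mem: "x \<in> E \<Longrightarrow> x \<in> central_orbit x"
  unfolding central_orbit_def
  using action_one subgroup.one_closed[OF Z_subgroup] by (metis image_eqI)

lemma central_orbit_subset: "x \<in> E \<Longrightarrow> central_orbit x \<subseteq> E"
  using action_closed Z_carrier by (auto simp: central_orbit_def)

lemma central_orbit_closed:
  assumes "x \<in> E" "g \<in> Z" "u \<in> E"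
  shows "\<phi> g u \<in> central_orbit x \<longleftrightarrow> u \<in> central_orbit x"
proof
  assume "u \<in> central_orbit x"
  then obtain h where h: "h \<in> Z" "u = \<phi> h x" by (auto simp: central_orbit_def)
  then have "\<phi> g u = \<phi> (g \<otimes> h) x"
    using composition_rule[of x g h] assms Z_carrier by simp
  moreover have "g \<otimes> h \<in> Z"
    using assms h Z_subgroup by (simp add: subgroup.m_closed)
  ultimately show "\<phi> g u \<in> central_orbit x" by (auto simp: central_orbit_def)
next
  assume "\<phi> g u \<in> central_orbit x"
  then obtain h where h: "h \<in> Z" "\<phi> g u = \<phi> h x" by (auto simp: central_orbit_def)
  have "u = \<phi> (inv g \<otimes> h) x"
    using composition_rule[of x "inv g" h] orbit_sym_aux[of g u] assms h Z_carrier by simp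
  moreover have "inv g \<otimes> h \<in> Z"
    using assms h Z_subgroup by (simp add: subgroup.m_closed subgroup.m_inv_closed)
  ultimately show "u \<in> central_orbit x" by (auto simp: central_orbit_def)
qed

text \<open>The stabilizers of \<open>x\<close> in \<open>G\<close> and in \<open>Z\<close>
  coincide, so the orbit lengths differ by the factor 4, the index of \<open>Z\<close>.\<close>

lemma card_orbit:
  assumes "x \<in> E" "\<phi> z x \<noteq> x"
  shows "card (orbit G \<phi> x) = 4 * card (central_orbit x)"
proof -
  have "stabilizer G \<phi> x = central_stabilizer x"
    using stabilizer_central[OF assms] Z_carrier
    by (auto simp: stabilizer_def central_stabilizer_def)
  then have "card (orbit G \<phi> x) * card (central_stabilizer x)
      = 4 * card (central_orbit x) * card (central_stabilizer x)"
    using orbit_stabilizer_theorem[OF assms(1)] central_orbit_stabilizer[OF assms(1)]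
    by (simp add: order_G)
  then show ?thesis using card_central_stabilizer_pos[OF assms(1)] by simp
qed

lemma card_central_orbit_ge_2:
  assumes "x \<in> E" "\<phi> z x \<noteq> x"
  shows "card (central_orbit x) \<ge> 2"
proof -
  have "{x, \<phi> z x} \<subseteq> central_orbit x"
    using central_orbit_mem[OF assms(1)] z(1) by (auto simp: central_orbit_def)
  moreover have "finite (central_orbit x)" using finite_Z by (simp add: central_orbit_def)
  ultimately have "card {x, \<phi> z x} \<le> card (central_orbit x)" by (intro card_mono)
  then show ?thesis using assms(2) by simp
qed

text \<open>Under the hypothesis \<open>outside\<close>, the involution that applies \<open>z\<close> on the central orbit of \<open>x\<close> only
  is an automorphism; it fixes points of \<open>Gx\<close>, whose stabilizers are central and hence fix \<open>x\<close>.\<close>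

lemma no_partial_central_involution:
  assumes x: "x \<in> E" "\<phi> z x \<noteq> x"
    and outside: "\<And>v. v \<in> E \<Longrightarrow> \<phi> z v \<noteq> v \<Longrightarrow> v \<notin> orbit G \<phi> x \<Longrightarrow>
      \<exists>h\<in>Z. \<phi> h v = v \<and> (\<forall>u\<in>central_orbit x. \<phi> h u = \<phi> z u)"
  shows False
proof -
  define f where "f = (\<lambda>v\<in>E. if v \<in> central_orbit x then \<phi> z v else v)"
  have zG: "z \<in> carrier G" using z(1) by (rule Z_carrier)
  have zz: "\<phi> z (\<phi> z v) = v" if "v \<in> E" for v
    using composition_rule[OF that zG zG] z(3) action_one that by simp
  \<comment> \<open>Only edges between the central orbit and its complement are at risk, so it
    suffices that \<open>u\<close> and \<open>z u\<close> have the same neighbours outside.\<close>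
  have key: "adj (\<phi> z u) v \<longleftrightarrow> adj u v"
    if u: "u \<in> central_orbit x" and v: "v \<in> E" "v \<notin> central_orbit x" for u v
  proof -
    have uE: "u \<in> E" using u central_orbit_subset[OF x(1)] by blast
    consider "\<phi> z v = v" | "\<phi> z v \<noteq> v" "v \<notin> orbit G \<phi> x" | "v \<in> orbit G \<phi> x" by blast
    then show ?thesis
    proof cases
      case 1
      then show ?thesis using adj_invariant[OF zG uE v(1)] by simp
    next
      case 2
      then obtain h where "h \<in> Z" "\<phi> h v = v" "\<phi> h u = \<phi> z u" using outside v(1) u by blast
      then show ?thesis using adj_invariant[OF _ uE v(1), of h] Z_carrier by simp
    next
      case 3
      then obtain s where s: "s \<in> carrier G" "v = \<phi> s x" by (auto simp: orbit_def)
      obtain c where c: "c \<in> Z" "u = \<phi> c x" using u by (auto simp: central_orbit_def)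
      \<comment> \<open>\<open>g\<close> takes \<open>u\<close> to \<open>v\<close>. It turns out to
        lie outside \<open>Z\<close>, so its square is \<open>z\<close>; hence it takes
        \<open>v\<close> to \<open>z u\<close>, and the pair \<open>u, v\<close> to
        \<open>v, z u\<close>.\<close>
      define g where "g = s \<otimes> inv c"
      have gG: "g \<in> carrier G" using s c Z_carrier by (simp add: g_def)
      have gu: "v = \<phi> g u"
      proof -
        have "\<phi> g u = \<phi> s (\<phi> (inv c) u)"
          using composition_rule[OF uE s(1), of "inv c"] c Z_carrier by (simp add: g_def)
        also have "\<phi> (inv c) u = x"
          using orbit_sym_aux[of c x u] c x Z_carrier by simp
        finally show ?thesis using s by simp
      qed
      have "g \<notin> Z" using central_orbit_closed[OF x(1) _ uE, of g] u v(2) gu by blast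
      then have "\<phi> g v = \<phi> z u"
        using square gG composition_rule[OF uE gG gG] gu by simp
      have "adj (\<phi> z u) v \<longleftrightarrow> adj (\<phi> g v) (\<phi> g u)" using \<open>\<phi> g v = \<phi> z u\<close> gu by simp
      also have "\<dots> \<longleftrightarrow> adj v u" using adj_invariant[OF gG v(1) uE] .
      finally show ?thesis using sym[OF v(1) uE] by simp
    qed
  qed
  have fE: "f v \<in> E" if "v \<in> E" for v using that action_closed[OF zG] by (simp add: f_def)
  have ff: "f (f v) = v" if "v \<in> E" for v
    using that fE[OF that] central_orbit_closed[OF x(1) z(1) that] zz[OF that] by (auto simp: f_def)
  have "bij_betw f E E"
    by (rule bij_betw_byWitness[where f' = f]) (use fE ff in auto)
  then have "f \<in> Bij E" by (simp add: Bij_def f_def)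
  moreover have "adj a b \<longleftrightarrow> adj (f a) (f b)" if ab: "a \<in> E" "b \<in> E" for a b
  proof -
    consider "a \<in> central_orbit x" "b \<in> central_orbit x"
      | "a \<in> central_orbit x" "b \<notin> central_orbit x"
      | "a \<notin> central_orbit x" "b \<in> central_orbit x"
      | "a \<notin> central_orbit x" "b \<notin> central_orbit x" by blast
    then show ?thesis
    proof cases
      case 3
      then have "adj (\<phi> z b) a \<longleftrightarrow> adj b a" using key ab by blast
      then show ?thesis using 3 ab sym[of a b] sym[of a "\<phi> z b"] action_closed[OF zG] by (simp add: f_def)
    qed (use ab key adj_invariant[OF zG ab] in \<open>simp_all add: f_def\<close>)
  qed
  ultimately have "f \<in> \<phi> ` carrier G" using image_iff by blast
  then obtain g where g: "g \<in> carrier G" "\<phi> g = f" by blast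
  have "\<not> carrier G \<subseteq> Z"
  proof
    assume "carrier G \<subseteq> Z"
    then have "order G \<le> card Z" unfolding order_def using finite_Z by (intro card_mono)
    then show False using order_G card_Z by simp
  qed
  then obtain s where s: "s \<in> carrier G" "s \<notin> Z" by blast
  \<comment> \<open>A vertex in the orbit of \<open>x\<close> on which \<open>f\<close> is the
    identity: \<open>s\<close>, being outside \<open>Z\<close>, moves \<open>x\<close> out of its
    central orbit.\<close>
  define v where "v = \<phi> s x"
  have v: "v \<in> E" using action_closed s x by (simp add: v_def)
  have "\<phi> z v \<noteq> v"
    using action_commute[OF z(1) s(1) x(1)] action_cancel[OF s(1) _ x(1)] action_closed[OF zG x(1)] x(2)
    by (simp add: v_def)
  have "v \<notin> central_orbit x"
  proof
    assume "v \<in> central_orbit x"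
    then obtain c where c: "c \<in> Z" "\<phi> s x = \<phi> c x" by (auto simp: central_orbit_def v_def)
    have "\<phi> (inv c \<otimes> s) x = x"
      using composition_rule[of x "inv c" s] orbit_sym_aux[of c x "\<phi> c x"] c s x Z_carrier by simp
    then have *: "inv c \<otimes> s \<in> Z"
      using stabilizer_central[OF x] c s Z_carrier by simp
    have "s = c \<otimes> (inv c \<otimes> s)" using c s Z_carrier by (simp flip: m_assoc)
    with * c have "s \<in> Z" using subgroup.m_closed[OF Z_subgroup] by metis
    with s show False by simp
  qed
  then have "\<phi> g v = v" using g v by (simp add: f_def)
  then have "g \<in> Z" using stabilizer_central[OF v \<open>\<phi> z v \<noteq> v\<close> g(1)] by simp
  \<comment> \<open>As \<open>g\<close> commutes with \<open>s\<close>, fixing \<open>s x\<close>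
    means fixing \<open>x\<close>; but \<open>f\<close> sends \<open>x\<close> to
    \<open>z x\<close>.\<close>
  then have "\<phi> s (\<phi> g x) = \<phi> s x"
    using action_commute[OF _ s(1) x(1), of g] \<open>\<phi> g v = v\<close> by (simp add: v_def)
  then have "\<phi> g x = x" using action_cancel[OF s(1) _ x(1)] action_closed g x by blast
  then show False using g x central_orbit_mem by (simp add: f_def)
qed

text \<open>Here \<open>b\<close> is the length of the orbit of \<open>y\<close> under the
  stabilizer of \<open>x\<close>, so \<open>card (central_orbit x) * b * card K = 2^(k+1)\<close>
  for the common stabilizer \<open>K\<close>. Being central, \<open>K\<close> fixes both orbits
  pointwise; it is therefore faithful on the remaining \<open>w\<close> vertices, and
  \<open>card K ^ 2\<close> is at most \<open>2 ^ w\<close>.\<close>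

lemma card_vertices_two_moved_orbits:
  assumes x: "x \<in> E" "\<phi> z x \<noteq> x" and y: "y \<in> E" "\<phi> z y \<noteq> y" "y \<notin> orbit G \<phi> x"
  obtains w b where "card E = 4 * card (central_orbit x) + 4 * card (central_orbit y) + w"
    and "2 ^ (2 * k + 2) \<le> (card (central_orbit x) * b) ^ 2 * 2 ^ w"
    and "b \<le> card (central_orbit y)"
    and "central_stabilizer x = central_stabilizer y \<Longrightarrow> b = 1"
proof -
  define W where "W = E - orbit G \<phi> x - orbit G \<phi> y"
  define B where "B = (\<lambda>g. \<phi> g y) ` central_stabilizer x"
  define K where "K = {g \<in> central_stabilizer x. \<phi> g y = y}"
  have stab_subgroup: "subgroup (central_stabilizer x) G"
    unfolding central_stabilizer_def using Z_subgroup x(1) by (rule subgroup_point_stabilizer)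
  have K_subgroup: "subgroup K G"
    unfolding K_def using stab_subgroup y(1) by (rule subgroup_point_stabilizer)
  have KZ: "K \<subseteq> Z" by (auto simp: K_def central_stabilizer_def)
  have "card B * card K = card (central_stabilizer x)"
    unfolding B_def K_def using stab_subgroup y(1) by (rule subgroup_orbit_stabilizer)
  then have prod: "card (central_orbit x) * card B * card K = 2 ^ Suc k"
    using central_orbit_stabilizer[OF x(1)] card_Z by (simp add: mult.assoc)
  have K_fix: "\<phi> g v = v" if g: "g \<in> K" and v: "v \<in> orbit G \<phi> x \<union> orbit G \<phi> y" for g v
  proof -
    obtain h a where h: "h \<in> carrier G" "v = \<phi> h a" "a = x \<or> a = y"
      using v by (auto simp: orbit_def)
    have "\<phi> g a = a" using g h(3) by (auto simp: K_def central_stabilizer_def)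
    moreover have "a \<in> E" using h(3) x y by blast
    ultimately show ?thesis using action_commute[of g h a] h KZ g by auto
  qed
  have orbE: "orbit G \<phi> a \<subseteq> E" if "a \<in> E" for a
    using that action_closed by (auto simp: orbit_def)
  have disj: "orbit G \<phi> x \<inter> orbit G \<phi> y = {}"
    using disjoint_union[of "orbit G \<phi> x" "orbit G \<phi> y"] x y orbit_refl[of y]
    by (auto simp: orbits_def)
  have "card K ^ 2 \<le> 2 ^ card W"
  proof (rule abelian_two_subgroup_bound[OF _ _ K_subgroup])
    show "finite W" "W \<subseteq> E" using finite_E by (auto simp: W_def)
    show "card K dvd 2 ^ Suc k" using prod by (metis dvd_triv_right)
    show "g \<otimes> h = h \<otimes> g" if "g \<in> K" "h \<in> K" for g h
      using that KZ Z_central Z_carrier by blast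
    show "\<phi> g v \<in> W" if g: "g \<in> K" and v: "v \<in> W" for g v
    proof -
      have gG: "g \<in> carrier G" using g KZ Z_carrier by blast
      have vE: "v \<in> E" using v by (simp add: W_def)
      have gvE: "\<phi> g v \<in> E" by (rule action_closed[OF gG vE])
      have "\<phi> g v \<notin> orbit G \<phi> x \<union> orbit G \<phi> y"
      proof
        assume *: "\<phi> g v \<in> orbit G \<phi> x \<union> orbit G \<phi> y"
        then have "\<phi> g (\<phi> g v) = \<phi> g v" using K_fix[OF g] by blast
        then have "\<phi> g v = v" using action_cancel[OF gG gvE vE] by simp
        with * v show False by (simp add: W_def)
      qed
      with gvE show ?thesis by (simp add: W_def)
    qed
    show "g = \<one>" if g: "g \<in> K" and fix_W: "\<And>v. v \<in> W \<Longrightarrow> \<phi> g v = v" for g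
    proof -
      have gG: "g \<in> carrier G" using g KZ Z_carrier by blast
      have "\<phi> g v = \<phi> \<one> v" for v
      proof (cases "v \<in> E")
        case True
        then have "\<phi> g v = v" using K_fix[OF g] fix_W by (auto simp: W_def)
        then show ?thesis using action_one[OF True] by simp
      next
        \<comment> \<open>Both permutations are extensional, thus \<open>undefined\<close> off
          \<open>E\<close>.\<close>
        case False
        then show ?thesis
          using bij_prop0[OF gG] bij_prop0[OF one_closed]
          by (auto simp: Bij_def extensional_def)
      qed
      then have "\<phi> g = \<phi> \<one>" by blast
      then show ?thesis using faithful gG one_closed by (auto dest: inj_onD)
    qed
  qed
  then have "(card (central_orbit x) * card B) ^ 2 * card K ^ 2
      \<le> (card (central_orbit x) * card B) ^ 2 * 2 ^ card W" by (rule mult_le_mono2)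
  moreover have "(card (central_orbit x) * card B) ^ 2 * card K ^ 2 = 2 ^ (2 * k + 2)"
    using prod by (simp flip: power_mult_distrib add: power_mult[symmetric] mult.commute del: power_Suc)
  moreover have "card E = 4 * card (central_orbit x) + 4 * card (central_orbit y) + card W"
  proof -
    have "E = (orbit G \<phi> x \<union> orbit G \<phi> y) \<union> W"
      using orbE[OF x(1)] orbE[OF y(1)] by (auto simp: W_def)
    moreover have "card \<dots> = card (orbit G \<phi> x \<union> orbit G \<phi> y) + card W"
      by (rule card_Un_disjoint)
        (use finite_E orbE[OF x(1)] orbE[OF y(1)] in \<open>auto simp: W_def intro: finite_subset\<close>)
    moreover have "card (orbit G \<phi> x \<union> orbit G \<phi> y) = card (orbit G \<phi> x) + card (orbit G \<phi> y)"
      by (rule card_Un_disjoint)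
        (use finite_E orbE[OF x(1)] orbE[OF y(1)] disj in \<open>auto intro: finite_subset\<close>)
    ultimately show ?thesis using card_orbit[OF x] card_orbit[OF y(1,2)] by simp
  qed
  moreover have "card B \<le> card (central_orbit y)"
    unfolding B_def central_orbit_def central_stabilizer_def
    using finite_Z by (intro card_mono) auto
  moreover have "card B = 1" if "central_stabilizer x = central_stabilizer y"
  proof -
    have "B = {y}"
      using subgroup.one_closed[OF stab_subgroup] that
      by (auto simp: B_def central_stabilizer_def image_iff)
    then show ?thesis by simp
  qed
  ultimately show ?thesis using that by metis
qed

text \<open>With \<open>s\<close> and \<open>t\<close> the sizes of the two central orbits, the
  preceding estimates leave room below \<open>16 + 2 * k\<close> only for \<open>s = t = 2\<close>
  and \<open>b > 1\<close>.\<close>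

lemma two_moved_orbits:
  assumes small: "card E < 16 + 2 * k"
    and x: "x \<in> E" "\<phi> z x \<noteq> x" and y: "y \<in> E" "\<phi> z y \<noteq> y" "y \<notin> orbit G \<phi> x"
  shows "card (central_orbit x) = 2" "card (central_orbit y) = 2"
    "central_stabilizer x \<noteq> central_stabilizer y"
proof -
  define s t where "s = card (central_orbit x)" and "t = card (central_orbit y)"
  obtain w b where E: "card E = 4 * s + 4 * t + w"
    and le: "2 ^ (2 * k + 2) \<le> (s * b) ^ 2 * (2::nat) ^ w"
    and b: "b \<le> t" "central_stabilizer x = central_stabilizer y \<Longrightarrow> b = 1"
    unfolding s_def t_def using card_vertices_two_moved_orbits[OF x y] by blast
  have st: "s \<ge> 2" "t \<ge> 2"
    using card_central_orbit_ge_2 x y by (auto simp: s_def t_def)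
  \<comment> \<open>Multiplying the bound on \<open>2 ^ (2 * k + 2)\<close> by \<open>2 ^ 14\<close>
    eliminates \<open>k\<close> and \<open>w\<close>; what remains is an inequality in
    \<open>s\<close>, \<open>t\<close> and \<open>b\<close> alone.\<close>
  have contra: False if "2 ^ 14 * (s * b) ^ 2 \<le> (2::nat) ^ (4 * s + 4 * t)"
  proof -
    have "(2::nat) ^ (16 + 2 * k) = 2 ^ 14 * 2 ^ (2 * k + 2)" by (simp add: power_add)
    also have "\<dots> \<le> 2 ^ 14 * ((s * b) ^ 2 * 2 ^ w)" using le by (rule mult_le_mono2)
    also have "\<dots> \<le> 2 ^ (4 * s + 4 * t) * 2 ^ w"
      using that mult_le_mono1[of _ _ "2 ^ w"] by (simp add: mult.assoc)
    also have "\<dots> = 2 ^ card E" by (simp add: E power_add)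
    finally show False using small by simp
  qed
  \<comment> \<open>The extra factor 2 absorbs the exception \<open>n = 3\<close>.\<close>
  have square_le: "n ^ 2 \<le> (2::nat) ^ Suc n" for n
  proof (cases "n = 3")
    case False
    then show ?thesis using square_le_two_power[of n] by simp
  qed simp
  \<comment> \<open>The exponent 14 is split as 8 + 6: an orbit size of at least 3 accounts for
    \<open>2 ^ 8\<close>, the other one, at least 2, for \<open>2 ^ 6\<close>. The latter is sharp
    at \<open>n = 2\<close>.\<close>
  have big: "2 ^ 8 * n ^ 2 \<le> (2::nat) ^ (4 * n)" if "n \<ge> 3" for n
  proof -
    have "2 ^ 8 * n ^ 2 \<le> 2 ^ 8 * (2::nat) ^ Suc n" using square_le by (rule mult_le_mono2)
    also have "\<dots> = 2 ^ (n + 9)" by (simp add: power_add)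
    also have "\<dots> \<le> 2 ^ (4 * n)" using that by (intro power_increasing) auto
    finally show ?thesis .
  qed
  have small2: "2 ^ 6 * n ^ 2 \<le> (2::nat) ^ (4 * n)" if "n \<ge> 2" for n
  proof (cases "n = 2")
    case False
    then show ?thesis using big[of n] that by simp
  qed simp
  have "s = 2 \<and> t = 2"
  proof (rule ccontr)
    assume "\<not> (s = 2 \<and> t = 2)"
    then have "s \<ge> 3 \<or> t \<ge> 3" using st by linarith
    then have "2 ^ 14 * (s * t) ^ 2 \<le> (2::nat) ^ (4 * s) * 2 ^ (4 * t)"
    proof
      assume "s \<ge> 3"
      then show ?thesis
        using mult_le_mono[OF big small2[OF st(2)], of s] by (simp add: power_mult_distrib)
    next
      assume "t \<ge> 3"
      then show ?thesis
        using mult_le_mono[OF small2[OF st(1)] big, of t] by (simp add: power_mult_distrib)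
    qed
    moreover have "2 ^ 14 * (s * b) ^ 2 \<le> 2 ^ 14 * (s * t) ^ 2"
      using b(1) by (intro mult_le_mono2 power_mono) auto
    ultimately have "2 ^ 14 * (s * b) ^ 2 \<le> (2::nat) ^ (4 * s + 4 * t)"
      unfolding power_add by (meson le_trans)
    then show False by (rule contra)
  qed
  then show "card (central_orbit x) = 2" "card (central_orbit y) = 2"
    by (simp_all add: s_def t_def)
  \<comment> \<open>Equal stabilizers would give \<open>b = 1\<close>, and
    \<open>2 ^ 14 * 2 ^ 2 = 2 ^ 16\<close> is just enough for \<open>contra\<close>.\<close>
  show "central_stabilizer x \<noteq> central_stabilizer y"
    using b(2) contra \<open>s = 2 \<and> t = 2\<close> by auto
qed

text \<open>In a smaller graph every vertex moved by \<open>z\<close> in a further orbit is fixed by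
  some \<open>h\<close> acting as \<open>z\<close> on the central orbit of \<open>x\<close>. This is
  the hypothesis \<open>outside\<close> of \<open>no_partial_central_involution\<close>; it holds
  vacuously when no further orbit is moved.\<close>

theorem card_vertices_ge: "16 + 2 * k \<le> card E"
proof (rule ccontr)
  assume "\<not> 16 + 2 * k \<le> card E"
  then have small: "card E < 16 + 2 * k" by simp
  have zG: "z \<in> carrier G" using z(1) by (rule Z_carrier)
  have "\<exists>x\<in>E. \<phi> z x \<noteq> x"
  proof (rule ccontr)
    assume "\<not> ?thesis"
    then have "\<phi> z v = \<phi> \<one> v" for v
      using action_one[of v] bij_prop0[OF zG] bij_prop0[OF one_closed]
      by (cases "v \<in> E") (auto simp: Bij_def extensional_def)
    then have "\<phi> z = \<phi> \<one>" by blast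
    then show False using faithful zG one_closed z(2) by (auto dest: inj_onD)
  qed
  then obtain x where x: "x \<in> E" "\<phi> z x \<noteq> x" by blast
  show False
  proof (rule no_partial_central_involution[OF x])
    fix v assume v: "v \<in> E" "\<phi> z v \<noteq> v" "v \<notin> orbit G \<phi> x"
    note two = two_moved_orbits[OF small x v]
    have "card (central_stabilizer v) = card (central_stabilizer x)"
      using central_orbit_stabilizer[OF x(1)] central_orbit_stabilizer[OF v(1)] two by simp
    moreover have "finite (central_stabilizer x)"
      using finite_Z by (simp add: central_stabilizer_def)
    ultimately have "\<not> central_stabilizer v \<subseteq> central_stabilizer x"
      using two(3) card_subset_eq by metis
    then obtain h where h: "h \<in> Z" "\<phi> h v = v" "\<phi> h x \<noteq> x"
      by (auto simp: central_stabilizer_def)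
    \<comment> \<open>The central orbit consists of \<open>x\<close> and \<open>z x\<close> only, so
      \<open>h\<close>, which moves \<open>x\<close>, agrees with \<open>z\<close> at
      \<open>x\<close>; centrality carries this to the whole central orbit.\<close>
    have "{\<phi> h x, \<phi> z x, x} \<subseteq> central_orbit x"
      using h(1) z(1) central_orbit_mem[OF x(1)] by (auto simp: central_orbit_def)
    moreover have "finite (central_orbit x)" using finite_Z by (simp add: central_orbit_def)
    ultimately have "card {\<phi> h x, \<phi> z x, x} \<le> 2" using two(1) card_mono by metis
    then have hz: "\<phi> h x = \<phi> z x" using h(3) x(2) by (auto split: if_splits simp: card_insert_if)
    have "\<phi> h u = \<phi> z u" if u: "u \<in> central_orbit x" for u
    proof -
      obtain c where "c \<in> Z" "u = \<phi> c x" using u by (auto simp: central_orbit_def)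
      then show ?thesis using action_commute h(1) z(1) x(1) hz Z_carrier by metis
    qed
    then show "\<exists>h\<in>Z. \<phi> h v = v \<and> (\<forall>u\<in>central_orbit x. \<phi> h u = \<phi> z u)" using h by blast
  qed
qed

end

section \<open>The group and its centre\<close>

lemma Q8_carrier: "carrier Q8 = {0..<4} \<times> {0..<2}" by (simp add: Q8_def)
lemma Q8_one: "\<one>\<^bsub>Q8\<^esub> = (0, 0)" by (simp add: Q8_def)
lemma Q8_mult: "(a, b) \<otimes>\<^bsub>Q8\<^esub> (c, d) =
  ((a + (if b = 0 then c else - c) + (if b = 1 \<and> d = 1 then 2 else 0)) mod 4, (b + d) mod 2)"
  by (simp add: Q8_def)

text \<open>An explicit list lets the simplifier verify the group laws case by case.\<close>

lemma Q8_carrier_enum: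
  "carrier Q8 = {(0, 0), (1, 0), (2, 0), (3, 0), (0, 1), (1, 1), (2, 1), (3, 1)}"
proof -
  have "{0..<4} = {0, 1, 2, 3 :: int}" "{0..<2} = {0, 1 :: int}" by (simp_all add: set_eq_iff; presburger)+
  then show ?thesis unfolding Q8_carrier by auto
qed

lemma group_Q8: "group Q8"
proof (rule groupI)
  have "\<forall>x\<in>carrier Q8. \<forall>y\<in>carrier Q8. x \<otimes>\<^bsub>Q8\<^esub> y \<in> carrier Q8"
    unfolding Q8_carrier_enum by (simp add: Q8_mult)
  then show "x \<otimes>\<^bsub>Q8\<^esub> y \<in> carrier Q8" if "x \<in> carrier Q8" "y \<in> carrier Q8" for x y
    using that by blast
  show "\<one>\<^bsub>Q8\<^esub> \<in> carrier Q8" by (simp add: Q8_carrier_enum Q8_one)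
  show "\<one>\<^bsub>Q8\<^esub> \<otimes>\<^bsub>Q8\<^esub> x = x" if "x \<in> carrier Q8" for x
    using that by (cases x) (simp add: Q8_carrier Q8_one Q8_mult)
  have "\<forall>x\<in>carrier Q8. \<forall>y\<in>carrier Q8. \<forall>w\<in>carrier Q8.
      x \<otimes>\<^bsub>Q8\<^esub> y \<otimes>\<^bsub>Q8\<^esub> w = x \<otimes>\<^bsub>Q8\<^esub> (y \<otimes>\<^bsub>Q8\<^esub> w)"
    unfolding Q8_carrier_enum by (simp add: Q8_mult)
  then show "x \<otimes>\<^bsub>Q8\<^esub> y \<otimes>\<^bsub>Q8\<^esub> w = x \<otimes>\<^bsub>Q8\<^esub> (y \<otimes>\<^bsub>Q8\<^esub> w)"
    if "x \<in> carrier Q8" "y \<in> carrier Q8" "w \<in> carrier Q8" for x y w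
    using that by blast
  show "\<exists>y\<in>carrier Q8. y \<otimes>\<^bsub>Q8\<^esub> x = \<one>\<^bsub>Q8\<^esub>" if "x \<in> carrier Q8" for x
    using that unfolding Q8_carrier_enum by (elim insertE) (auto simp: Q8_mult Q8_one)
qed

lemma order_Q8: "order Q8 = 8"
  by (simp add: order_def Q8_carrier card_cartesian_product)

lemma group_elem_abelian_2: "group (elem_abelian_2 k)"
  by (simp add: elem_abelian_2_def)

lemma card_elem_abelian_2: "card (carrier (elem_abelian_2 k)) = 2 ^ k"
  by (simp add: elem_abelian_2_def card_PiE carrier_integer_mod_group)

lemma elem_abelian_2_comm:
  "c \<otimes>\<^bsub>elem_abelian_2 k\<^esub> d = d \<otimes>\<^bsub>elem_abelian_2 k\<^esub> c"
  by (simp add: elem_abelian_2_def add.commute)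

lemma elem_abelian_2_square:
  assumes "c \<in> carrier (elem_abelian_2 k)"
  shows "c \<otimes>\<^bsub>elem_abelian_2 k\<^esub> c = \<one>\<^bsub>elem_abelian_2 k\<^esub>"
  using assms by (auto simp: elem_abelian_2_def intro!: restrict_ext)

abbreviation Q8_C2k :: "nat \<Rightarrow> ((int \<times> int) \<times> (nat \<Rightarrow> int)) monoid" where
  "Q8_C2k k \<equiv> Q8 \<times>\<times> elem_abelian_2 k"

text \<open>The pair \<open>(2, 0)\<close> is \<open>sigma^2\<close>, the only involution of the
  quaternion group.\<close>

definition Q8_C2k_center :: "nat \<Rightarrow> ((int \<times> int) \<times> (nat \<Rightarrow> int)) set" where
  "Q8_C2k_center k = {(0, 0), (2, 0)} \<times> carrier (elem_abelian_2 k)"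

lemma group_Q8_C2k: "group (Q8_C2k k)"
  by (simp add: DirProd_group group_Q8 group_elem_abelian_2)

lemma order_Q8_C2k: "order (Q8_C2k k) = 2 ^ (k + 3)"
  using order_Q8 by (simp add: order_def card_cartesian_product card_elem_abelian_2 power_add)

lemma card_Q8_C2k_center: "card (Q8_C2k_center k) = 2 ^ Suc k"
  by (simp add: Q8_C2k_center_def card_cartesian_product card_elem_abelian_2)

lemma Q8_C2k_center_square:
  assumes "g \<in> Q8_C2k_center k"
  shows "g \<otimes>\<^bsub>Q8_C2k k\<^esub> g = \<one>\<^bsub>Q8_C2k k\<^esub>"
  using assms elem_abelian_2_square by (auto simp: Q8_C2k_center_def Q8_mult Q8_one)

lemma subgroup_Q8_C2k_center: "subgroup (Q8_C2k_center k) (Q8_C2k k)"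
proof -
  interpret group "Q8_C2k k" by (rule group_Q8_C2k)
  interpret A: group "elem_abelian_2 k" by (rule group_elem_abelian_2)
  show ?thesis
  proof (rule subgroupI)
    show sub: "Q8_C2k_center k \<subseteq> carrier (Q8_C2k k)"
      by (auto simp: Q8_C2k_center_def Q8_carrier)
    show "Q8_C2k_center k \<noteq> {}"
      using A.one_closed by (auto simp: Q8_C2k_center_def)
    show "inv\<^bsub>Q8_C2k k\<^esub> g \<in> Q8_C2k_center k" if "g \<in> Q8_C2k_center k" for g
    proof -
      have "inv\<^bsub>Q8_C2k k\<^esub> g = g"
        using Q8_C2k_center_square[OF that] sub that by (intro inv_equality) auto
      with that show ?thesis by simp
    qed
    show "g \<otimes>\<^bsub>Q8_C2k k\<^esub> h \<in> Q8_C2k_center k" 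
      if "g \<in> Q8_C2k_center k" "h \<in> Q8_C2k_center k" for g h
      using that A.m_closed by (auto simp: Q8_C2k_center_def Q8_mult)
  qed
qed

lemma Q8_C2k_center_commute:
  assumes "g \<in> Q8_C2k_center k" "h \<in> carrier (Q8_C2k k)"
  shows "g \<otimes>\<^bsub>Q8_C2k k\<^esub> h = h \<otimes>\<^bsub>Q8_C2k k\<^esub> g"
  using assms elem_abelian_2_comm[of k "snd g" "snd h"]
  by (auto simp: Q8_C2k_center_def Q8_carrier_enum Q8_mult)

text \<open>All six elements of order 4 in \<open>Q8\<close> have square \<open>sigma^2\<close>, and
  squares are trivial in the second factor.\<close>

lemma Q8_C2k_square_noncentral:
  assumes "g \<in> carrier (Q8_C2k k)" "g \<notin> Q8_C2k_center k"
  shows "g \<otimes>\<^bsub>Q8_C2k k\<^esub> g = ((2, 0), \<one>\<^bsub>elem_abelian_2 k\<^esub>)"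
  using assms elem_abelian_2_square
  by (auto simp: Q8_C2k_center_def Q8_carrier_enum Q8_mult)

section \<open>Graph automorphisms as a subgroup of the symmetric group\<close>

lemma subgroup_graph_automorphisms:
  "subgroup {f \<in> Bij V. \<forall>x\<in>V. \<forall>y\<in>V. E x y \<longleftrightarrow> E (f x) (f y)} (BijGroup V)"
proof -
  interpret group "BijGroup V" by (rule group_BijGroup)
  have BijD: "f x \<in> V" if "f \<in> Bij V" "x \<in> V" for f x
    using that Bij_imp_funcset by blast
  show ?thesis
  proof (rule subgroupI)
    show "{f \<in> Bij V. \<forall>x\<in>V. \<forall>y\<in>V. E x y \<longleftrightarrow> E (f x) (f y)} \<noteq> {}"
      using id_Bij[of V] by (intro ex_in_conv[THEN iffD1] exI[of _ "\<lambda>x\<in>V. x"]) auto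
  next
    fix f assume f: "f \<in> {f \<in> Bij V. \<forall>x\<in>V. \<forall>y\<in>V. E x y \<longleftrightarrow> E (f x) (f y)}"
    let ?g = "\<lambda>x\<in>V. inv_into V f x"
    have g: "?g \<in> Bij V" using f by (intro restrict_inv_into_Bij) simp
    have "f (?g x) = x" if "x \<in> V" for x
      using f that by (simp add: Bij_def bij_betw_def f_inv_into_f)
    \<comment> \<open>Preservation of edges is an equivalence, so the inverse permutation inherits
      it.\<close>
    moreover have "E (?g x) (?g y) \<longleftrightarrow> E (f (?g x)) (f (?g y))" if "x \<in> V" "y \<in> V" for x y
      using f BijD[OF g that(1)] BijD[OF g that(2)] by blast
    ultimately have "\<forall>x\<in>V. \<forall>y\<in>V. E x y \<longleftrightarrow> E (?g x) (?g y)" by (simp only: refl Ball_def) blast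
    then show "inv\<^bsub>BijGroup V\<^esub> f \<in> {f \<in> Bij V. \<forall>x\<in>V. \<forall>y\<in>V. E x y \<longleftrightarrow> E (f x) (f y)}"
      using f g by (simp add: inv_BijGroup)
  next
    fix f g
    assume "f \<in> {f \<in> Bij V. \<forall>x\<in>V. \<forall>y\<in>V. E x y \<longleftrightarrow> E (f x) (f y)}"
      and "g \<in> {f \<in> Bij V. \<forall>x\<in>V. \<forall>y\<in>V. E x y \<longleftrightarrow> E (f x) (f y)}"
    then show "f \<otimes>\<^bsub>BijGroup V\<^esub> g \<in> {f \<in> Bij V. \<forall>x\<in>V. \<forall>y\<in>V. E x y \<longleftrightarrow> E (f x) (f y)}"
      using BijD by (auto simp: BijGroup_def compose_Bij compose_eq)
  qed (auto simp: BijGroup_def)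
qed

lemma group_graph_aut_group: "group (graph_aut_group V E)"
  unfolding graph_aut_group_def
  using subgroup_graph_automorphisms group_BijGroup by (rule subgroup.subgroup_is_group)

lemma carrier_graph_aut_group:
  "carrier (graph_aut_group V E) = {f \<in> Bij V. \<forall>x\<in>V. \<forall>y\<in>V. E x y \<longleftrightarrow> E (f x) (f y)}"
  by (simp add: graph_aut_group_def)

lemma mult_graph_aut_group:
  assumes "f \<in> carrier (graph_aut_group V E)" "g \<in> carrier (graph_aut_group V E)"
  shows "f \<otimes>\<^bsub>graph_aut_group V E\<^esub> g = compose V f g"
  using assms by (simp add: graph_aut_group_def BijGroup_def)

text \<open>An isomorphism from the abstract group onto the automorphism group is itself an action
  on \<open>V\<close>: injectivity makes it faithful, and surjectivity makes its image the full
  automorphism group.\<close>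

theorem card_vertices_Q8_C2k:
  assumes graph: "simple_graph V E" and iso: "graph_aut_group V E \<cong> Q8_C2k k"
  shows "16 + 2 * k \<le> card V"
proof -
  interpret group "Q8_C2k k" by (rule group_Q8_C2k)
  have "Q8_C2k k \<cong> graph_aut_group V E"
    using group.iso_sym[OF group_graph_aut_group iso] .
  then obtain \<psi> where \<psi>: "\<psi> \<in> iso (Q8_C2k k) (graph_aut_group V E)"
    unfolding is_iso_def by blast
  then have hom: "\<psi> \<in> hom (Q8_C2k k) (graph_aut_group V E)"
    and bij: "bij_betw \<psi> (carrier (Q8_C2k k)) (carrier (graph_aut_group V E))"
    by (auto simp: iso_def)
  have "\<psi> \<in> hom (Q8_C2k k) (BijGroup V)"
    using hom by (auto simp: hom_def graph_aut_group_def BijGroup_def)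
  then interpret group_action "Q8_C2k k" V \<psi>
    by (simp add: group_action_def group_hom_def group_hom_axioms_def group_BijGroup group_Q8_C2k)
  have one: "\<one>\<^bsub>elem_abelian_2 k\<^esub> \<in> carrier (elem_abelian_2 k)"
    by (simp add: group_elem_abelian_2 group.is_monoid)
  interpret quaternionic_graph_action "Q8_C2k k" V \<psi> E "Q8_C2k_center k"
    "((2, 0), \<one>\<^bsub>elem_abelian_2 k\<^esub>)" k
  proof (intro quaternionic_graph_action.intro quaternionic_graph_action_axioms.intro, goal_cases)
    case 1 then show ?case by (rule group_action_axioms)
  next
    case 2 then show ?case using graph by (simp add: simple_graph_def)
  next
    case 3 then show ?case using bij by (simp add: bij_betw_def)
  next
    case (4 x y) then show ?case using graph by (simp add: simple_graph_def)
  next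
    case (5 f) then show ?case using bij by (simp add: bij_betw_def carrier_graph_aut_group)
  next
    case 6 then show ?case by (rule subgroup_Q8_C2k_center)
  next
    case (7 g h) then show ?case by (rule Q8_C2k_center_commute)
  next
    case 8 then show ?case by (rule card_Q8_C2k_center)
  next
    case 9 then show ?case by (simp add: order_Q8_C2k card_Q8_C2k_center power_add)
  next
    case 10 then show ?case using one by (simp add: Q8_C2k_center_def)
  next
    case 11 then show ?case by (simp add: Q8_one)
  next
    case 12 then show ?case
      using Q8_C2k_center_square[of "((2, 0), \<one>\<^bsub>elem_abelian_2 k\<^esub>)" k] one
      by (simp add: Q8_C2k_center_def)
  next
    case (13 g) then show ?case by (rule Q8_C2k_square_noncentral)
  qed
  show ?thesis by (rule card_vertices_ge)
qed

section \<open>Adding a pair of vertices\<close>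

lemma C2_carrier: "carrier C2 = {0, 1}"
  by (auto simp: carrier_integer_mod_group)

text \<open>After complementation every old vertex then misses some other vertex, which tells it
  apart from the two new, dominating ones.\<close>

definition no_isolated_vertex :: "nat \<Rightarrow> (nat \<Rightarrow> nat \<Rightarrow> bool) \<Rightarrow> bool" where
  "no_isolated_vertex n E \<longleftrightarrow> (\<forall>x<n. \<exists>y<n. E x y)"

text \<open>The complement of the disjoint union with two isolated vertices: complementing makes the new
  vertices dominating, so that the result again has no isolated vertex and the step can be iterated.\<close>

definition add_twins :: "nat \<Rightarrow> (nat \<Rightarrow> nat \<Rightarrow> bool) \<Rightarrow> nat \<Rightarrow> nat \<Rightarrow> bool" where
  "add_twins n E x y \<longleftrightarrow> x \<noteq> y \<and> \<not> (x < n \<and> y < n \<and> E x y)"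

lemma simple_graph_add_twins:
  "simple_graph {..<n} E \<Longrightarrow> simple_graph {..<n + 2} (add_twins n E)"
  by (auto simp: simple_graph_def add_twins_def)

lemma no_isolated_vertex_add_twins: "no_isolated_vertex (n + 2) (add_twins n E)"
  unfolding no_isolated_vertex_def
proof (intro allI impI)
  fix x :: nat
  show "\<exists>y<n + 2. add_twins n E x y"
    by (rule exI[of _ "if x = n then n + 1 else n"]) (simp add: add_twins_def)
qed

text \<open>Subtraction from \<open>2 * n + 1\<close> exchanges the new vertices \<open>n\<close>
  and \<open>n + 1\<close>; the bit \<open>c\<close> decides whether this happens. Restriction is
  there because elements of \<open>Bij\<close> are extensional.\<close>

definition extend_aut :: "nat \<Rightarrow> (nat \<Rightarrow> nat) \<times> int \<Rightarrow> nat \<Rightarrow> nat" where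
  "extend_aut n = (\<lambda>(h, c). \<lambda>v\<in>{..<n + 2}. if v < n then h v else if c = 0 then v else 2 * n + 1 - v)"

lemma extend_aut_simps:
  "v < n \<Longrightarrow> extend_aut n (h, c) v = h v"
  "extend_aut n (h, c) n = (if c = 0 then n else n + 1)"
  "extend_aut n (h, c) (Suc n) = (if c = 0 then Suc n else n)"
  "\<not> v < n + 2 \<Longrightarrow> extend_aut n (h, c) v = undefined"
  by (auto simp: extend_aut_def)

text \<open>Automorphisms preserve the set of vertices adjacent to all others. Without isolated
  vertices in \<open>E\<close> this set is \<open>{n, n + 1}\<close>, so every automorphism splits
  into one of the old graph and a permutation of the new pair.\<close>

lemma extend_aut_iso:
  assumes graph: "simple_graph {..<n} E" and noiso: "no_isolated_vertex n E"
  shows "extend_aut n \<in> iso (graph_aut_group {..<n} E \<times>\<times> C2) (graph_aut_group {..<n + 2} (add_twins n E))"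
proof -
  let ?A = "carrier (graph_aut_group {..<n} E)"
  let ?B = "carrier (graph_aut_group {..<n + 2} (add_twins n E))"
  have A_lt: "v < n \<longrightarrow> h v < n" if "h \<in> ?A" for h v
    using that by (auto simp: carrier_graph_aut_group Bij_def bij_betw_def)
  have A_inj: "v < n \<longrightarrow> w < n \<longrightarrow> h v = h w \<longleftrightarrow> v = w" if "h \<in> ?A" for h v w
    using that by (auto simp: carrier_graph_aut_group Bij_def bij_betw_def inj_on_eq_iff)
  have A_adj: "v < n \<longrightarrow> w < n \<longrightarrow> E (h v) (h w) \<longleftrightarrow> E v w" if "h \<in> ?A" for h v w
    using that by (auto simp: carrier_graph_aut_group)
  have inj_ext: "extend_aut n (h, c) v = extend_aut n (h, c) w \<longleftrightarrow> v = w"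
    if "h \<in> ?A" "v < n + 2" "w < n + 2" for h c v w
    using that(2,3) A_lt[OF that(1), of v] A_lt[OF that(1), of w] A_inj[OF that(1), of v w]
    by (auto simp: extend_aut_def)
  have lt: "extend_aut n (h, c) v < n \<longleftrightarrow> v < n" if "h \<in> ?A" "v < n + 2" for h c v
    using that(2) A_lt[OF that(1), of v] by (auto simp: extend_aut_def)
  have closed: "extend_aut n (h, c) \<in> ?B" if h: "h \<in> ?A" and c: "c \<in> carrier C2" for h c
  proof -
    let ?f = "extend_aut n (h, c)"
    have "inj_on ?f {..<n + 2}" using inj_ext[OF h] by (auto simp: inj_on_def)
    moreover have "?f v < n + 2" if "v < n + 2" for v
      using that A_lt[OF h, of v] by (auto simp: extend_aut_def)
    then have "?f ` {..<n + 2} \<subseteq> {..<n + 2}" by blast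
    ultimately have "bij_betw ?f {..<n + 2} {..<n + 2}"
      by (simp add: bij_betw_def endo_inj_surj)
    moreover have "add_twins n E x y \<longleftrightarrow> add_twins n E (?f x) (?f y)"
      if "x < n + 2" "y < n + 2" for x y
      using inj_ext[OF h that, of c] lt[OF h that(1), of c] lt[OF h that(2), of c] A_adj[OF h, of x y]
      by (auto simp: add_twins_def extend_aut_def)
    ultimately show ?thesis
      by (simp add: carrier_graph_aut_group Bij_def extend_aut_def)
  qed
  have "extend_aut n \<in> hom (graph_aut_group {..<n} E \<times>\<times> C2) (graph_aut_group {..<n + 2} (add_twins n E))"
  proof (rule homI)
    fix p assume "p \<in> carrier (graph_aut_group {..<n} E \<times>\<times> C2)"
    then show "extend_aut n p \<in> ?B" using closed by auto
  next
    fix p q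
    assume "p \<in> carrier (graph_aut_group {..<n} E \<times>\<times> C2)" "q \<in> carrier (graph_aut_group {..<n} E \<times>\<times> C2)"
    then obtain h c h' c' where pq: "p = (h, c)" "q = (h', c')" "h \<in> ?A" "h' \<in> ?A"
        "c \<in> carrier C2" "c' \<in> carrier C2"
      by auto
    have "extend_aut n (compose {..<n} h h', (c + c') mod 2) v
        = compose {..<n + 2} (extend_aut n (h, c)) (extend_aut n (h', c')) v" for v
    proof -
      have cc: "c = 0 \<or> c = 1" "c' = 0 \<or> c' = 1" using pq(5,6) unfolding C2_carrier by simp_all
      consider "v < n" | "v = n" | "v = Suc n" | "\<not> v < n + 2" by linarith
      then show ?thesis
      proof cases
        case 1
        then show ?thesis using A_lt[OF pq(4), of v] by (simp add: extend_aut_simps compose_def)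
      next
        case 2
        then show ?thesis using cc by (elim disjE) (simp_all add: extend_aut_simps compose_def)
      next
        case 3
        then show ?thesis using cc by (elim disjE) (simp_all add: extend_aut_simps compose_def)
      next
        case 4
        then show ?thesis by (simp add: extend_aut_simps compose_def)
      qed
    qed
    then have "extend_aut n (compose {..<n} h h', (c + c') mod 2)
        = compose {..<n + 2} (extend_aut n (h, c)) (extend_aut n (h', c'))" by blast
    then show "extend_aut n (p \<otimes>\<^bsub>graph_aut_group {..<n} E \<times>\<times> C2\<^esub> q)
        = extend_aut n p \<otimes>\<^bsub>graph_aut_group {..<n + 2} (add_twins n E)\<^esub> extend_aut n q"
      using pq closed by (simp add: mult_graph_aut_group)
  qed
  moreover have "inj_on (extend_aut n) (?A \<times> carrier C2)"
  proof (rule inj_onI, clarify)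
    fix h c h' c' assume h: "h \<in> ?A" "h' \<in> ?A" and c: "c \<in> carrier C2" "c' \<in> carrier C2"
      and eq: "extend_aut n (h, c) = extend_aut n (h', c')"
    have "h v = h' v" if "v < n" for v
      using fun_cong[OF eq, of v] that by (simp add: extend_aut_def)
    then have "h = h'"
      using h by (intro extensionalityI[of h "{..<n}"]) (auto simp: carrier_graph_aut_group Bij_def)
    moreover have "c = c'"
      using fun_cong[OF eq, of n] c by (auto simp: extend_aut_def C2_carrier)
    ultimately show "h = h' \<and> c = c'" by simp
  qed
  moreover have "?B \<subseteq> extend_aut n ` (?A \<times> carrier C2)"
  proof
    fix f assume f: "f \<in> ?B"
    have f_lt: "f v < n + 2" if "v < n + 2" for v
      using f that by (auto simp: carrier_graph_aut_group Bij_def bij_betw_def)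
    have f_inj: "f v = f w \<longleftrightarrow> v = w" if "v < n + 2" "w < n + 2" for v w
      using f that by (auto simp: carrier_graph_aut_group Bij_def bij_betw_def inj_on_def)
    have "f ` {..<n + 2} = {..<n + 2}"
      using f by (simp add: carrier_graph_aut_group Bij_def bij_betw_def)
    \<comment> \<open>Surjectivity of \<open>f\<close> allows the bound vertex to be replaced by an
      image under \<open>f\<close>.\<close>
    then have "(\<exists>w\<in>{..<n + 2}. P w) \<longleftrightarrow> (\<exists>w\<in>{..<n + 2}. P (f w))" for P
      using bex_simps(7)[of f "{..<n + 2}" P] by (simp only:)
    then have ex_f: "(\<exists>w<n + 2. P w) \<longleftrightarrow> (\<exists>w<n + 2. P (f w))" for P
      unfolding Bex_def lessThan_iff .
    have f_adj: "add_twins n E (f v) (f w) \<longleftrightarrow> add_twins n E v w" if "v < n + 2" "w < n + 2" for v w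
      using f that by (simp add: carrier_graph_aut_group)
    \<comment> \<open>Old vertices are described by adjacency alone, a description that
      \<open>f\<close> preserves.\<close>
    have dominating: "v < n \<longleftrightarrow> (\<exists>w<n + 2. w \<noteq> v \<and> \<not> add_twins n E v w)" if "v < n + 2" for v
    proof
      assume "v < n"
      then obtain w where w: "w < n" "E v w" using noiso by (auto simp: no_isolated_vertex_def)
      then have "w \<noteq> v" using graph by (auto simp: simple_graph_def)
      with w \<open>v < n\<close> show "\<exists>w<n + 2. w \<noteq> v \<and> \<not> add_twins n E v w"
        by (intro exI[of _ w]) (simp add: add_twins_def)
    qed (auto simp: add_twins_def)
    have f_lt_n: "f v < n \<longleftrightarrow> v < n" if v: "v < n + 2" for v
    proof -
      have "f v < n \<longleftrightarrow> (\<exists>w<n + 2. w \<noteq> f v \<and> \<not> add_twins n E (f v) w)"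
        by (rule dominating) (rule f_lt[OF v])
      also have "\<dots> \<longleftrightarrow> (\<exists>w<n + 2. f w \<noteq> f v \<and> \<not> add_twins n E (f v) (f w))"
        by (rule ex_f)
      also have "\<dots> \<longleftrightarrow> (\<exists>w<n + 2. w \<noteq> v \<and> \<not> add_twins n E v w)"
        using f_inj f_adj v by blast
      also have "\<dots> \<longleftrightarrow> v < n" using dominating[OF v] by simp
      finally show ?thesis .
    qed
    define h where "h = restrict f {..<n}"
    define c :: int where "c = (if f n = n then 0 else 1)"
    have "inj_on h {..<n}" using f_inj by (auto simp: inj_on_def h_def)
    moreover have "h ` {..<n} \<subseteq> {..<n}" using f_lt_n by (auto simp: h_def)
    ultimately have "bij_betw h {..<n} {..<n}" by (simp add: bij_betw_def endo_inj_surj)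
    \<comment> \<open>\<open>add_twins\<close> reflects \<open>E\<close> only between distinct
      vertices; on the diagonal irreflexivity is used.\<close>
    moreover have "E x y \<longleftrightarrow> E (h x) (h y)" if "x < n" "y < n" for x y
    proof (cases "x = y")
      case True
      then show ?thesis using that graph f_lt_n by (simp add: simple_graph_def h_def)
    next
      case False
      then show ?thesis
        using that f_adj[of x y] f_inj[of x y] f_lt_n[of x] f_lt_n[of y] by (simp add: add_twins_def h_def)
    qed
    ultimately have "h \<in> ?A" by (simp add: carrier_graph_aut_group Bij_def h_def)
    moreover have "f = extend_aut n (h, c)"
    proof
      fix v
      have f_top: "f n = n \<or> f n = n + 1" "f (n + 1) = n \<or> f (n + 1) = n + 1" "f n \<noteq> f (n + 1)"
        using f_lt[of n] f_lt[of "n + 1"] f_lt_n[of n] f_lt_n[of "n + 1"] f_inj[of n "n + 1"] by auto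
      consider "v < n" | "v = n" | "v = Suc n" | "\<not> v < n + 2" by linarith
      then show "f v = extend_aut n (h, c) v"
      proof cases
        case 1
        then show ?thesis by (simp add: extend_aut_simps h_def)
      next
        case 2
        then show ?thesis using f_top by (auto simp: extend_aut_simps c_def)
      next
        case 3
        then show ?thesis using f_top by (auto simp: extend_aut_simps c_def)
      next
        case 4
        then show ?thesis
          using f by (simp add: carrier_graph_aut_group Bij_def extensional_def extend_aut_simps)
      qed
    qed
    ultimately show "f \<in> extend_aut n ` (?A \<times> carrier C2)"
      by (intro image_eqI[of _ _ "(h, c)"]) (auto simp: c_def C2_carrier)
  qed
  ultimately show ?thesis
    using closed by (auto simp: iso_def bij_betw_def image_subset_iff)
qed

section \<open>Elementary abelian groups, one coordinate at a time\<close>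

lemma elem_abelian_2_carrier: "c \<in> carrier (elem_abelian_2 k) \<longleftrightarrow> (\<forall>i<k. c i = 0 \<or> c i = 1) \<and> (\<forall>i. \<not> i < k \<longrightarrow> c i = undefined)"
  unfolding elem_abelian_2_def carrier_product_group C2_carrier
  by (simp add: PiE_iff extensional_def Ball_def)

lemma elem_abelian_2_mult: "(c \<otimes>\<^bsub>elem_abelian_2 k\<^esub> d) i = (if i < k then (c i + d i) mod 2 else undefined)"
  by (simp add: elem_abelian_2_def)

text \<open>Splits off the last coordinate, so that each pair of new vertices contributes one
  coordinate.\<close>

lemma elem_abelian_2_Suc_iso:
  "(\<lambda>((q, c), d). (q, c(k := d))) \<in> iso ((G \<times>\<times> elem_abelian_2 k) \<times>\<times> C2) (G \<times>\<times> elem_abelian_2 (Suc k))"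
proof -
  let ?f = "\<lambda>((q, c :: nat \<Rightarrow> int), d). (q, c(k := d))"
  have upd: "c(k := d) \<in> carrier (elem_abelian_2 (Suc k))"
    if "c \<in> carrier (elem_abelian_2 k)" "d \<in> carrier C2" for c d
    using that by (simp add: elem_abelian_2_carrier C2_carrier less_Suc_eq)
  have mult: "(c \<otimes>\<^bsub>elem_abelian_2 k\<^esub> c')(k := (d + d') mod 2)
      = c(k := d) \<otimes>\<^bsub>elem_abelian_2 (Suc k)\<^esub> c'(k := d')" for c c' d d'
    by (rule ext) (simp add: elem_abelian_2_mult less_Suc_eq)
  \<comment> \<open>Restriction resets coordinate \<open>k\<close> to \<open>undefined\<close>, the
    value that elements of \<open>elem_abelian_2 k\<close> take there.\<close>
  have res: "restrict c {..<k} \<in> carrier (elem_abelian_2 k)" "c k \<in> carrier C2"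
    "(restrict c {..<k})(k := c k) = c" if "c \<in> carrier (elem_abelian_2 (Suc k))" for c
    using that by (simp_all add: elem_abelian_2_carrier C2_carrier less_Suc_eq fun_eq_iff)
  have "restrict (c(k := d)) {..<k} = c" if "c \<in> carrier (elem_abelian_2 k)" for c d
    using that by (simp add: elem_abelian_2_carrier fun_eq_iff)
  then have "bij_betw ?f ((carrier G \<times> carrier (elem_abelian_2 k)) \<times> carrier C2)
      (carrier G \<times> carrier (elem_abelian_2 (Suc k)))"
    using upd res
    by (intro bij_betw_byWitness[where f' = "\<lambda>(q, c). ((q, restrict c {..<k}), c k)"]) auto
  moreover have "?f \<in> hom ((G \<times>\<times> elem_abelian_2 k) \<times>\<times> C2) (G \<times>\<times> elem_abelian_2 (Suc k))"
    using upd mult by (auto simp: hom_def)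
  ultimately show ?thesis by (simp add: iso_def)
qed

lemma elem_abelian_2_0_iso:
  "(\<lambda>q. (q, \<one>\<^bsub>elem_abelian_2 0\<^esub>)) \<in> iso G (G \<times>\<times> elem_abelian_2 0)"
proof -
  have "carrier (elem_abelian_2 0) = {\<one>\<^bsub>elem_abelian_2 0\<^esub>}"
    "\<one>\<^bsub>elem_abelian_2 0\<^esub> \<otimes>\<^bsub>elem_abelian_2 0\<^esub> \<one>\<^bsub>elem_abelian_2 0\<^esub> = \<one>\<^bsub>elem_abelian_2 0\<^esub>"
    by (simp_all add: elem_abelian_2_def restrict_def)
  then show ?thesis by (auto simp: iso_def hom_def bij_betw_def inj_on_def)
qed

section \<open>A graph on 16 vertices\<close>

text \<open>The vertex \<open>v < 16\<close> stands for the element \<open>\<sigma>^(v mod 4) \<tau>^(v div 4 mod 2)\<close> in the copy \<open>v div 8\<close> of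
  \<open>Q\<^sub>8\<close>. The copies are the Cayley graphs of \<open>{\<sigma>, \<sigma>\<inverse>}\<close> and \<open>{\<sigma>\<^sup>2, \<tau>, \<tau>\<inverse>}\<close>, and \<open>u\<close> in the first is
  joined to \<open>us\<close> in the second for \<open>s \<in> {1, \<sigma>, \<tau>}\<close>. This connection set was found by computer search.\<close>

definition vertex_label :: "nat \<Rightarrow> int \<times> int" where
  "vertex_label v = (int (v mod 4), int (v div 4 mod 2))"

text \<open>The product is written back as a vertex number with digits of weight 8, 4 and 1; the
  leading digit, the copy of \<open>Q8\<close>, is kept.\<close>

definition left_translation :: "int \<times> int \<Rightarrow> nat \<Rightarrow> nat" where
  "left_translation g v = (let (a, b) = g \<otimes>\<^bsub>Q8\<^esub> vertex_label v in 8 * (v div 8) + 4 * nat b + nat a)"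

text \<open>Connection elements multiply on the right, so that left translations cancel.\<close>

definition cayley_edge :: "(int \<times> int) set \<Rightarrow> nat \<Rightarrow> nat \<Rightarrow> bool" where
  "cayley_edge S u v \<longleftrightarrow> (\<exists>s\<in>S. vertex_label v = vertex_label u \<otimes>\<^bsub>Q8\<^esub> s)"

definition Q8_graph :: "nat \<Rightarrow> nat \<Rightarrow> bool" where
  "Q8_graph u v \<longleftrightarrow>
    (if u < 8 then if v < 8 then cayley_edge {(1, 0), (3, 0)} u v
                   else cayley_edge {(0, 0), (1, 0), (0, 1)} u v
     else if v < 8 then cayley_edge {(0, 0), (1, 0), (0, 1)} v u
          else cayley_edge {(2, 0), (0, 1), (2, 1)} u v)"

text \<open>Tabulated adjacency lists, by which the later finite checks become set
  computations.\<close>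

definition Q8_graph_neighbours :: "nat list list" where
  "Q8_graph_neighbours =
    [[1, 3, 8, 9, 12], [0, 2, 9, 10, 13], [1, 3, 10, 11, 14], [0, 2, 8, 11, 15],
     [5, 7, 10, 12, 15], [4, 6, 11, 12, 13], [5, 7, 8, 13, 14], [4, 6, 9, 14, 15],
     [0, 3, 6, 10, 12, 14], [0, 1, 7, 11, 13, 15], [1, 2, 4, 8, 12, 14], [2, 3, 5, 9, 13, 15],
     [0, 4, 5, 8, 10, 14], [1, 5, 6, 9, 11, 15], [2, 6, 7, 8, 10, 12], [3, 4, 7, 9, 11, 13]]"

lemma lessThan_16: "{..<16::nat} = {0, 1, 2, 3, 4, 5, 6, 7, 8, 9, 10, 11, 12, 13, 14, 15}"
  by (simp add: lessThan_nat_numeral lessThan_Suc insert_commute)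

lemma Q8_graph_iff: "\<forall>u\<in>{..<16}. \<forall>v\<in>{..<16}. Q8_graph u v \<longleftrightarrow> v \<in> set (Q8_graph_neighbours ! u)"
  unfolding lessThan_16
  by (simp add: Q8_graph_def cayley_edge_def vertex_label_def Q8_mult Q8_graph_neighbours_def)

lemma simple_graph_Q8_graph: "simple_graph {..<16} Q8_graph"
proof -
  have "\<forall>u\<in>{..<16}. \<forall>v\<in>{..<16}.
      (v \<in> set (Q8_graph_neighbours ! u) \<longleftrightarrow> u \<in> set (Q8_graph_neighbours ! v)) \<and> u \<notin> set (Q8_graph_neighbours ! u)"
    unfolding lessThan_16 by (simp add: Q8_graph_neighbours_def)
  then show ?thesis using Q8_graph_iff by (simp add: simple_graph_def)
qed

lemma no_isolated_vertex_Q8_graph: "no_isolated_vertex 16 Q8_graph"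
proof -
  have "\<forall>u\<in>{..<16}. Q8_graph_neighbours ! u ! 0 < 16 \<and> Q8_graph_neighbours ! u ! 0 \<in> set (Q8_graph_neighbours ! u)"
    unfolding lessThan_16 by (simp add: Q8_graph_neighbours_def)
  then show ?thesis using Q8_graph_iff unfolding no_isolated_vertex_def by (meson lessThan_iff)
qed

section \<open>Rigidity of the graph on 16 vertices\<close>

definition Q8_graph_nbhd :: "nat \<Rightarrow> nat set" where
  "Q8_graph_nbhd u = {v \<in> {..<16}. Q8_graph u v}"

lemma Q8_graph_nbhd_eq: "u < 16 \<Longrightarrow> Q8_graph_nbhd u = set (Q8_graph_neighbours ! u)"
proof -
  have "\<forall>u\<in>{..<16}. set (Q8_graph_neighbours ! u) \<subseteq> {..<16}"
    unfolding lessThan_16 by (simp add: Q8_graph_neighbours_def)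
  then show "Q8_graph_nbhd u = set (Q8_graph_neighbours ! u)" if "u < 16"
    using that Q8_graph_iff by (auto simp: Q8_graph_nbhd_def)
qed

text \<open>Colour refinement after fixing the vertex 0: the first round uses the numbers of common neighbours
  with 0, the later ones only adjacency to vertices already known to be fixed.\<close>

lemma refinement_step_1:
  "\<forall>v\<in>{2, 8, 10}. \<forall>w\<in>{..<16}. (w < 8 \<longleftrightarrow> v < 8) \<longrightarrow> (w \<in> Q8_graph_nbhd 0 \<longleftrightarrow> v \<in> Q8_graph_nbhd 0) \<longrightarrow>
    card (Q8_graph_nbhd 0 \<inter> Q8_graph_nbhd w) = card (Q8_graph_nbhd 0 \<inter> Q8_graph_nbhd v) \<longrightarrow> w = 0 \<or> w = v"
  unfolding lessThan_16
  by (simp add: Q8_graph_nbhd_eq Q8_graph_neighbours_def)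

lemma refinement_step_2:
  "\<forall>v\<in>{1, 3, 4, 6, 9, 11, 12, 14}. \<forall>w\<in>{..<16}. (w < 8 \<longleftrightarrow> v < 8) \<longrightarrow>
    (\<forall>u\<in>{0, 2, 8, 10}. w \<in> Q8_graph_nbhd u \<longleftrightarrow> v \<in> Q8_graph_nbhd u) \<longrightarrow> w \<in> {0, 2, 8, 10} \<or> w = v"
  unfolding lessThan_16
  by (simp add: Q8_graph_nbhd_eq Q8_graph_neighbours_def)

lemma refinement_step_3:
  "\<forall>v\<in>{5, 7, 13, 15}. \<forall>w\<in>{..<16}. (w < 8 \<longleftrightarrow> v < 8) \<longrightarrow>
    (\<forall>u\<in>{0, 1, 2, 3, 4, 6, 8, 9, 10, 11, 12, 14}. w \<in> Q8_graph_nbhd u \<longleftrightarrow> v \<in> Q8_graph_nbhd u) \<longrightarrow>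
    w \<in> {0, 1, 2, 3, 4, 6, 8, 9, 10, 11, 12, 14} \<or> w = v"
  unfolding lessThan_16
  by (simp add: Q8_graph_nbhd_eq Q8_graph_neighbours_def)

lemma card_Q8_graph_nbhd: "\<forall>v\<in>{..<16}. card (Q8_graph_nbhd v) = (if v < 8 then 5 else 6)"
  unfolding lessThan_16 by (simp add: Q8_graph_nbhd_eq Q8_graph_neighbours_def)

lemma Q8_graph_automorphism_nbhd:
  assumes f: "f \<in> carrier (graph_aut_group {..<16} Q8_graph)"
  shows Q8_graph_automorphism_less: "v < 16 \<Longrightarrow> f v < 16"
    and Q8_graph_automorphism_inj: "inj_on f {..<16}"
    and Q8_graph_automorphism_nbhd_iff: "u < 16 \<Longrightarrow> w < 16 \<Longrightarrow> f w \<in> Q8_graph_nbhd (f u) \<longleftrightarrow> w \<in> Q8_graph_nbhd u"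
    and Q8_graph_automorphism_codegree:
      "u < 16 \<Longrightarrow> w < 16 \<Longrightarrow> card (Q8_graph_nbhd (f u) \<inter> Q8_graph_nbhd (f w)) = card (Q8_graph_nbhd u \<inter> Q8_graph_nbhd w)"
proof -
  have f_lt: "f v < 16" if "v < 16" for v
    using f that by (auto simp: carrier_graph_aut_group Bij_def bij_betw_def)
  have inj: "inj_on f {..<16}" and surj: "f ` {..<16} = {..<16}"
    using f by (simp_all add: carrier_graph_aut_group Bij_def bij_betw_def)
  have mem: "f w \<in> Q8_graph_nbhd (f u) \<longleftrightarrow> w \<in> Q8_graph_nbhd u" if "u < 16" "w < 16" for u w
    using f that f_lt by (simp add: Q8_graph_nbhd_def carrier_graph_aut_group)
  have Q8_graph_nbhd_sub: "Q8_graph_nbhd u \<subseteq> {..<16}" for u by (auto simp: Q8_graph_nbhd_def)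
  have image: "Q8_graph_nbhd (f u) = f ` Q8_graph_nbhd u" if "u < 16" for u
  proof
    show "f ` Q8_graph_nbhd u \<subseteq> Q8_graph_nbhd (f u)" using mem[OF that] Q8_graph_nbhd_sub[of u] by blast
    show "Q8_graph_nbhd (f u) \<subseteq> f ` Q8_graph_nbhd u"
    proof
      fix w assume w: "w \<in> Q8_graph_nbhd (f u)"
      then obtain w' where "w' < 16" "w = f w'" using Q8_graph_nbhd_sub[of "f u"] surj by blast
      then show "w \<in> f ` Q8_graph_nbhd u" using mem[OF that, of w'] w by blast
    qed
  qed
  have codegree: "card (Q8_graph_nbhd (f u) \<inter> Q8_graph_nbhd (f w)) = card (Q8_graph_nbhd u \<inter> Q8_graph_nbhd w)" if "u < 16" "w < 16" for u w
  proof -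
    have "Q8_graph_nbhd (f u) \<inter> Q8_graph_nbhd (f w) = f ` (Q8_graph_nbhd u \<inter> Q8_graph_nbhd w)"
      using image[OF that(1)] image[OF that(2)] inj_on_image_Int[OF inj Q8_graph_nbhd_sub Q8_graph_nbhd_sub] by simp
    moreover have "inj_on f (Q8_graph_nbhd u \<inter> Q8_graph_nbhd w)" using inj Q8_graph_nbhd_sub by (meson inj_on_subset le_infI1)
    ultimately show ?thesis by (simp add: card_image)
  qed
  show "v < 16 \<Longrightarrow> f v < 16" "inj_on f {..<16}"
    "u < 16 \<Longrightarrow> w < 16 \<Longrightarrow> f w \<in> Q8_graph_nbhd (f u) \<longleftrightarrow> w \<in> Q8_graph_nbhd u"
    "u < 16 \<Longrightarrow> w < 16 \<Longrightarrow> card (Q8_graph_nbhd (f u) \<inter> Q8_graph_nbhd (f w)) = card (Q8_graph_nbhd u \<inter> Q8_graph_nbhd w)"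
    by (use f_lt inj mem codegree in blast)+
qed

text \<open>The codegree of a vertex with itself is its degree, which is 5 in the first copy and 6
  in the second.\<close>

lemma Q8_graph_automorphism_layer:
  assumes "f \<in> carrier (graph_aut_group {..<16} Q8_graph)" "v < 16"
  shows "f v < 8 \<longleftrightarrow> v < 8"
proof -
  have "(if f v < 8 then 5 else 6) = (if v < 8 then 5 else 6 :: nat)"
    using Q8_graph_automorphism_codegree[OF assms(1) assms(2) assms(2)] Q8_graph_automorphism_less[OF assms] assms(2)
      card_Q8_graph_nbhd by simp
  then show ?thesis by (auto split: if_splits)
qed

text \<open>In each refinement round \<open>w\<close> and \<open>f w\<close> carry the same colour,
  and the finite check leaves only \<open>w\<close> itself or a vertex already fixed. Three rounds
  exhaust the graph.\<close>

lemma Q8_graph_stabilizer_trivial: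
  assumes f: "f \<in> carrier (graph_aut_group {..<16} Q8_graph)" and "f 0 = 0" and "v < 16"
  shows "f v = v"
proof -
  note f_lt = Q8_graph_automorphism_less[OF f] and layer = Q8_graph_automorphism_layer[OF f]
  have adjacent: "f w \<in> Q8_graph_nbhd u \<longleftrightarrow> w \<in> Q8_graph_nbhd u" if "f u = u" "u < 16" "w < 16" for u w
    using Q8_graph_automorphism_nbhd_iff[OF f that(2,3)] that(1) by simp
  \<comment> \<open>If \<open>f w\<close> is among the fixed vertices, then
    \<open>f (f w) = f w\<close>, and injectivity gives \<open>f w = w\<close>.\<close>
  have extend: "f w = w" if "f w \<in> A \<or> f w = w" "\<And>u. u \<in> A \<Longrightarrow> f u = u \<and> u < 16" "w < 16" for w A
    using that inj_onD[OF Q8_graph_automorphism_inj[OF f], of "f w" w] f_lt[of w] by auto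
  have fix1: "f w = w" if "w \<in> {2, 8, 10}" for w
  proof (rule extend[of _ "{0}"])
    show w: "w < 16" using that by auto
    have *: "f w \<in> {..<16}" using f_lt[OF w] by simp
    have **: "card (Q8_graph_nbhd 0 \<inter> Q8_graph_nbhd (f w)) = card (Q8_graph_nbhd 0 \<inter> Q8_graph_nbhd w)"
      using Q8_graph_automorphism_codegree[OF f, of 0 w] w \<open>f 0 = 0\<close> by simp
    have "f w = 0 \<or> f w = w"
      using refinement_step_1[THEN bspec, OF that, THEN bspec, OF *, THEN mp, OF layer[OF w], THEN mp, OF adjacent[of 0 w]]
        ** w \<open>f 0 = 0\<close> by simp
    then show "f w \<in> {0} \<or> f w = w" by simp
  qed (use \<open>f 0 = 0\<close> in auto)
  have fixed: "f u = u \<and> u < 16" if "u \<in> {0, 2, 8, 10}" for u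
    using that fix1[of u] \<open>f 0 = 0\<close> by auto
  have fix2: "f w = w" if "w \<in> {1, 3, 4, 6, 9, 11, 12, 14}" for w
  proof (rule extend[of _ "{0, 2, 8, 10}"])
    show w: "w < 16" using that by auto
    have *: "f w \<in> {..<16}" using f_lt[OF w] by simp
    have **: "\<forall>u\<in>{0, 2, 8, 10}. f w \<in> Q8_graph_nbhd u \<longleftrightarrow> w \<in> Q8_graph_nbhd u"
      using adjacent[OF _ _ w] fixed by blast
    show "f w \<in> {0, 2, 8, 10} \<or> f w = w"
      by (rule refinement_step_2[THEN bspec, OF that, THEN bspec, OF *, THEN mp, OF layer[OF w], THEN mp, OF **])
    show "f u = u \<and> u < 16" if "u \<in> {0, 2, 8, 10}" for u using that by (rule fixed)
  qed
  have fixed': "f u = u \<and> u < 16" if "u \<in> {0, 1, 2, 3, 4, 6, 8, 9, 10, 11, 12, 14}" for u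
    using that fixed[of u] fix2[of u] by auto
  have fix3: "f w = w" if "w \<in> {5, 7, 13, 15}" for w
  proof (rule extend[of _ "{0, 1, 2, 3, 4, 6, 8, 9, 10, 11, 12, 14}"])
    show w: "w < 16" using that by auto
    have *: "f w \<in> {..<16}" using f_lt[OF w] by simp
    have **: "\<forall>u\<in>{0, 1, 2, 3, 4, 6, 8, 9, 10, 11, 12, 14}. f w \<in> Q8_graph_nbhd u \<longleftrightarrow> w \<in> Q8_graph_nbhd u"
      using adjacent[OF _ _ w] fixed' by blast
    show "f w \<in> {0, 1, 2, 3, 4, 6, 8, 9, 10, 11, 12, 14} \<or> f w = w"
      by (rule refinement_step_3[THEN bspec, OF that, THEN bspec, OF *, THEN mp, OF layer[OF w], THEN mp, OF **])
    show "f u = u \<and> u < 16" if "u \<in> {0, 1, 2, 3, 4, 6, 8, 9, 10, 11, 12, 14}" for u using that by (rule fixed')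
  qed
  have "v \<in> {..<16}" using \<open>v < 16\<close> by simp
  then have "v \<in> {0, 1, 2, 3, 4, 6, 8, 9, 10, 11, 12, 14} \<or> v \<in> {5, 7, 13, 15}"
    unfolding lessThan_16 by blast
  then show ?thesis
  proof
    assume "v \<in> {0, 1, 2, 3, 4, 6, 8, 9, 10, 11, 12, 14}"
    then show ?thesis by (rule fixed'[THEN conjunct1])
  next
    assume "v \<in> {5, 7, 13, 15}"
    then show ?thesis by (rule fix3)
  qed
qed

section \<open>Left translations as graph automorphisms\<close>

lemma vertex_label_carrier: "vertex_label v \<in> carrier Q8"
  by (simp add: vertex_label_def Q8_carrier)

lemma vertex_eqI:
  assumes "u div 8 = v div 8" "vertex_label u = vertex_label v"
  shows "u = v"
proof -
  have digits: "w = 8 * (w div 8) + 4 * (w div 4 mod 2) + w mod 4" for w :: nat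
    using div_mult_mod_eq[of w 4] div_mult_mod_eq[of "w div 4" 2] div_mult2_eq[of w 4 2, simplified]
    by linarith
  have "u mod 4 = v mod 4" "u div 4 mod 2 = v div 4 mod 2"
    using assms(2) by (simp_all add: vertex_label_def)
  then show ?thesis using assms(1) digits[of u] digits[of v] by metis
qed

lemma left_translation:
  assumes "g \<in> carrier Q8"
  shows vertex_label_left_translation: "vertex_label (left_translation g v) = g \<otimes>\<^bsub>Q8\<^esub> vertex_label v"
    and layer_left_translation: "left_translation g v div 8 = v div 8"
proof -
  obtain a b where ab: "g \<otimes>\<^bsub>Q8\<^esub> vertex_label v = (a, b)" by fastforce
  have "(a, b) \<in> carrier Q8"
    using assms vertex_label_carrier group_Q8 ab by (metis group.is_monoid monoid.m_closed)
  then have "0 \<le> a" "a < 4" "0 \<le> b" "b < 2" by (auto simp: Q8_carrier)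
  moreover define i j where "i = nat a" and "j = nat b"
  ultimately have ij: "a = int i" "b = int j" "i < 4" "j < 2" by auto
  have L: "left_translation g v = 8 * (v div 8) + 4 * j + i"
    using ab ij by (simp add: left_translation_def)
  have "(8 * q + 4 * j + i) mod 4 = i" "(8 * q + 4 * j + i) div 4 mod 2 = j" "(8 * q + 4 * j + i) div 8 = q" for q
    using ij(3,4) by presburger+
  then show "vertex_label (left_translation g v) = g \<otimes>\<^bsub>Q8\<^esub> vertex_label v"
    "left_translation g v div 8 = v div 8"
    unfolding ab unfolding L by (simp_all add: vertex_label_def ij)
qed

lemma left_translation_less:
  assumes "g \<in> carrier Q8"
  shows "left_translation g v < 8 \<longleftrightarrow> v < 8" and "left_translation g v < 16 \<longleftrightarrow> v < 16"
proof -
  have less: "u < 8 \<longleftrightarrow> u div 8 = 0" "u < 16 \<longleftrightarrow> u div 8 < 2" for u :: nat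
    by (simp_all add: div_eq_0_iff div_less_iff_less_mult)
  show "left_translation g v < 8 \<longleftrightarrow> v < 8" "left_translation g v < 16 \<longleftrightarrow> v < 16"
    unfolding less layer_left_translation[OF assms] by (rule refl)+
qed

lemma left_translation_mult:
  assumes "g \<in> carrier Q8" "h \<in> carrier Q8"
  shows "left_translation (g \<otimes>\<^bsub>Q8\<^esub> h) v = left_translation g (left_translation h v)"
proof -
  interpret group Q8 by (rule group_Q8)
  show ?thesis
    by (rule vertex_eqI)
      (simp_all add: assms vertex_label_carrier layer_left_translation vertex_label_left_translation m_assoc)
qed

lemma left_translation_one: "left_translation \<one>\<^bsub>Q8\<^esub> v = v"
proof -
  interpret group Q8 by (rule group_Q8)
  show ?thesis
    by (rule vertex_eqI)
      (simp_all add: vertex_label_carrier layer_left_translation vertex_label_left_translation)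
qed

lemma cayley_edge_left_translation:
  assumes "g \<in> carrier Q8" "S \<subseteq> carrier Q8"
  shows "cayley_edge S (left_translation g u) (left_translation g v) \<longleftrightarrow> cayley_edge S u v"
proof -
  interpret group Q8 by (rule group_Q8)
  have "g \<otimes>\<^bsub>Q8\<^esub> vertex_label v = g \<otimes>\<^bsub>Q8\<^esub> vertex_label u \<otimes>\<^bsub>Q8\<^esub> s
      \<longleftrightarrow> vertex_label v = vertex_label u \<otimes>\<^bsub>Q8\<^esub> s" if "s \<in> S" for s
  proof -
    have "s \<in> carrier Q8" using that assms(2) by blast
    then show ?thesis
      using assms(1) vertex_label_carrier[of u] vertex_label_carrier[of v] by (simp add: m_assoc)
  qed
  then show ?thesis
    using assms(1) unfolding cayley_edge_def by (simp add: vertex_label_left_translation)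
qed

lemma Q8_graph_left_translation:
  assumes "g \<in> carrier Q8"
  shows "Q8_graph (left_translation g u) (left_translation g v) \<longleftrightarrow> Q8_graph u v"
proof -
  have "{(1, 0), (3, 0)} \<subseteq> carrier Q8" "{(0, 0), (1, 0), (0, 1)} \<subseteq> carrier Q8"
    "{(2, 0), (0, 1), (2, 1)} \<subseteq> carrier Q8"
    by (simp_all add: Q8_carrier)
  then show ?thesis
    using assms unfolding Q8_graph_def
    by (simp only: left_translation_less cayley_edge_left_translation)
qed

text \<open>Vertex 0 is labelled by the identity, so the image of 0 determines a translation. Any
  automorphism agrees with some translation at 0, and their quotient fixes 0, hence is
  trivial.\<close>

lemma left_translation_iso:
  "(\<lambda>g. restrict (left_translation g) {..<16}) \<in> iso Q8 (graph_aut_group {..<16} Q8_graph)"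
proof -
  interpret group Q8 by (rule group_Q8)
  let ?L = "\<lambda>g. restrict (left_translation g) {..<16}"
  let ?A = "carrier (graph_aut_group {..<16} Q8_graph)"
  have inv_cancel: "left_translation (inv\<^bsub>Q8\<^esub> g) (left_translation g v) = v"
    "left_translation g (left_translation (inv\<^bsub>Q8\<^esub> g) v) = v" if "g \<in> carrier Q8" for g v
    using that by (simp_all add: left_translation_one flip: left_translation_mult)
  have label_0: "vertex_label (left_translation g 0) = g" if "g \<in> carrier Q8" for g
  proof -
    have "vertex_label 0 = \<one>\<^bsub>Q8\<^esub>" by (simp add: vertex_label_def Q8_one)
    then show ?thesis using vertex_label_left_translation[OF that, of 0] r_one[OF that] by metis
  qed
  have closed: "?L g \<in> ?A" if g: "g \<in> carrier Q8" for g
  proof -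
    have "bij_betw (?L g) {..<16} {..<16}"
      using g inv_cancel[OF g]
      by (intro bij_betw_byWitness[where f' = "left_translation (inv\<^bsub>Q8\<^esub> g)"])
        (auto simp: left_translation_less)
    then show ?thesis
      using g by (simp add: carrier_graph_aut_group Bij_def Q8_graph_left_translation)
  qed
  have "?L (g \<otimes>\<^bsub>Q8\<^esub> h) = compose {..<16} (?L g) (?L h)" if "g \<in> carrier Q8" "h \<in> carrier Q8" for g h
    using that by (intro ext) (simp add: compose_def left_translation_mult left_translation_less)
  then have "?L \<in> hom Q8 (graph_aut_group {..<16} Q8_graph)"
    using closed by (intro homI) (simp_all add: mult_graph_aut_group)
  moreover have "inj_on ?L (carrier Q8)"
  proof (rule inj_onI)
    fix g h assume gh: "g \<in> carrier Q8" "h \<in> carrier Q8" and eq: "?L g = ?L h"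
    have "left_translation g 0 = left_translation h 0"
      using fun_cong[OF eq, of 0] by simp
    then show "g = h" using label_0[OF gh(1)] label_0[OF gh(2)] by metis
  qed
  moreover have "?A \<subseteq> ?L ` carrier Q8"
  proof
    interpret A: group "graph_aut_group {..<16} Q8_graph" by (rule group_graph_aut_group)
    fix f assume f: "f \<in> ?A"
    define g where "g = vertex_label (f 0)"
    have g: "g \<in> carrier Q8" by (simp add: g_def vertex_label_carrier)
    have f_lt: "f v < 16" if "v < 16" for v
      using f that by (auto simp: carrier_graph_aut_group Bij_def bij_betw_def)
    \<comment> \<open>A label determines a vertex only together with its copy; this places
      \<open>f 0\<close> in the copy of 0.\<close>
    have "f 0 < 8" using Q8_graph_automorphism_layer[OF f, of 0] by simp
    have "left_translation g 0 = f 0"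
    proof (rule vertex_eqI)
      show "left_translation g 0 div 8 = f 0 div 8"
        using layer_left_translation[OF g, of 0] \<open>f 0 < 8\<close> by simp
      show "vertex_label (left_translation g 0) = vertex_label (f 0)"
        using label_0[OF g] by (simp add: g_def)
    qed
    define h where "h = compose {..<16} (?L (inv\<^bsub>Q8\<^esub> g)) f"
    have h: "h \<in> ?A"
      unfolding h_def using A.m_closed[OF closed f, of "inv\<^bsub>Q8\<^esub> g"] g f closed
      by (simp add: mult_graph_aut_group)
    have h_eq: "h v = left_translation (inv\<^bsub>Q8\<^esub> g) (f v)" if "v < 16" for v
      using that f_lt by (simp add: h_def compose_def)
    have "h 0 = 0"
      using h_eq[of 0] inv_cancel(1)[OF g, of 0] \<open>left_translation g 0 = f 0\<close> by simp
    have "f v = ?L g v" for v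
    proof (cases "v < 16")
      case True
      then have "h v = v" by (rule Q8_graph_stabilizer_trivial[OF h \<open>h 0 = 0\<close>])
      then have "left_translation g v = f v" using h_eq[OF True] inv_cancel(2)[OF g] by metis
      then show ?thesis using True by simp
    next
      case False
      then show ?thesis using f by (simp add: carrier_graph_aut_group Bij_def extensional_def)
    qed
    then have "f = ?L g" by blast
    then show "f \<in> ?L ` carrier Q8" using g by blast
  qed
  ultimately show ?thesis
    using closed by (auto simp: iso_def bij_betw_def image_subset_iff)
qed

text \<open>Each induction step adds two vertices and one factor \<open>C2\<close>. The absence of
  isolated vertices is carried along because the next step relies on it.\<close>

lemma Q8_C2k_graph_exists:
  "\<exists>E. simple_graph {..<16 + 2 * k} E \<and> no_isolated_vertex (16 + 2 * k) E \<and>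
    graph_aut_group {..<16 + 2 * k} E \<cong> Q8 \<times>\<times> elem_abelian_2 k"
proof (induction k)
  case 0
  have "graph_aut_group {..<16} Q8_graph \<cong> Q8"
    using left_translation_iso group_Q8 group.iso_sym is_iso_def by blast
  also have "Q8 \<cong> Q8 \<times>\<times> elem_abelian_2 0"
    using elem_abelian_2_0_iso unfolding is_iso_def by blast
  finally show ?case
    using simple_graph_Q8_graph no_isolated_vertex_Q8_graph by auto
next
  case (Suc k)
  then obtain E where E: "simple_graph {..<16 + 2 * k} E" "no_isolated_vertex (16 + 2 * k) E"
    and iso: "graph_aut_group {..<16 + 2 * k} E \<cong> Q8 \<times>\<times> elem_abelian_2 k"
    by blast
  let ?n = "16 + 2 * k"
  have "graph_aut_group {..<?n} E \<times>\<times> C2 \<cong> graph_aut_group {..<?n + 2} (add_twins ?n E)"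
    using extend_aut_iso[OF E] unfolding is_iso_def by blast
  then have "graph_aut_group {..<?n + 2} (add_twins ?n E) \<cong> graph_aut_group {..<?n} E \<times>\<times> C2"
    by (rule group.iso_sym[OF DirProd_group[OF group_graph_aut_group group_integer_mod_group]])
  also have "\<dots> \<cong> (Q8 \<times>\<times> elem_abelian_2 k) \<times>\<times> C2"
    by (rule group.DirProd_iso_trans[OF group_graph_aut_group iso iso_refl])
  also have "\<dots> \<cong> Q8 \<times>\<times> elem_abelian_2 (Suc k)"
    using elem_abelian_2_Suc_iso unfolding is_iso_def by blast
  finally show ?case
    using simple_graph_add_twins[OF E(1)] no_isolated_vertex_add_twins[of ?n E]
    by (intro exI[of _ "add_twins ?n E"]) (simp add: add.commute)
qed

theorem theorem3:
  fixes k :: nat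
  assumes "k \<ge> 1"
  shows "alpha (Q8 \<times>\<times> elem_abelian_2 k) = 16 + 2 * k"
proof -
  let ?P = "\<lambda>n. \<exists>E. simple_graph {..<n} E \<and> graph_aut_group {..<n} E \<cong> Q8 \<times>\<times> elem_abelian_2 k"
  obtain E where "simple_graph {..<16 + 2 * k} E"
    and "graph_aut_group {..<16 + 2 * k} E \<cong> Q8 \<times>\<times> elem_abelian_2 k"
    using Q8_C2k_graph_exists[of k] by (elim exE conjE)
  then have "?P (16 + 2 * k)" by (intro exI[of _ E] conjI)
  moreover have "16 + 2 * k \<le> n" if "?P n" for n
  proof -
    obtain E where "simple_graph {..<n} E" "graph_aut_group {..<n} E \<cong> Q8 \<times>\<times> elem_abelian_2 k"
      using \<open>?P n\<close> by (elim exE conjE)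
    from card_vertices_Q8_C2k[OF this] show ?thesis by simp
  qed
  ultimately show ?thesis unfolding alpha_def by (rule Least_equality)
qed

end
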